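(* Let $r\ge1$ and $\ell\ge2$ be integers, and let $b_\ell^{(r)}(n)$ be defined by $\sum_{n\ge0} b_\ell^{(r)}(n)q^n=\prod_{j=1}^\infty\left(\frac{1-q^{\ell j}}{1-q^j}\right)^r$. For every integer $d\ge1$, the Jensen polynomial $$J_{b_\ell^{(r)}}^{d,n}(X)=\sum_{i=0}^d\binom di\, b_\ell^{(r)}(n+i)\,X^i$$ is hyperbolic (i.e. has only real roots) for all but finitely many values of $n$. *)

theory Defs
  imports "HOL-Computational_Algebra.Computational_Algebra"
begin

definition eta_factor :: "nat \<Rightarrow> nat \<Rightarrow> nat \<Rightarrow> real fps" where
  "eta_factor l r j = ((1 - fps_X ^ (l * j)) * inverse (1 - fps_X ^ j)) ^ r"

text \<open>The coefficient of q^n in the infinite product only depends on the factors with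
  j \<le> n (each factor is 1 + O(q^j)), so it equals the coefficient in the finite product
  over j = 1..n.\<close>
definition b_coeff :: "nat \<Rightarrow> nat \<Rightarrow> nat \<Rightarrow> real" where
  "b_coeff l r n = fps_nth (\<Prod>j\<in>{1..n}. eta_factor l r j) n"

definition jensen_poly :: "(nat \<Rightarrow> real) \<Rightarrow> nat \<Rightarrow> nat \<Rightarrow> complex poly" where
  "jensen_poly a d n = (\<Sum>i\<le>d. monom (of_nat (d choose i) * of_real (a (n + i))) i)"

definition hyperbolic :: "complex poly \<Rightarrow> bool" where
  "hyperbolic p \<longleftrightarrow> p \<noteq> 0 \<and> (\<forall>z. poly p z = 0 \<longrightarrow> z \<in> \<real>)"

end

theory Submission
  imports Defs "HOL-Complex_Analysis.Complex_Analysis" "HOL-Probability.Probability"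
begin

text \<open>
  The factors with \<open>l\<close> dividing \<open>j\<close> cancel, so the generating function is the product of
  \<open>(1 - q^j)^(-r)\<close> over the \<open>j\<close> not divisible by \<open>l\<close>; for the coefficients up to \<open>n + d\<close> only
  \<open>j \<le> n + d\<close> matter, so every product below is finite. On the circle \<open>q = exp (-s + \<i> t)\<close> this
  product, divided by its value at \<open>t = 0\<close>, is the characteristic function of a sum of independent
  geometric variables. Choose the saddle point \<open>s\<close> such that the mean is \<open>n\<close>, and let \<open>\<sigma>\<^sup>2\<close> be the
  variance, of order \<open>s^(-3)\<close>. Substituting \<open>X = - exp (-s) (1 - y / \<sigma>)\<close> in Cauchy's formula turns
  the Jensen polynomial, up to a positive factor, into the integral of the characteristic function
  against \<open>(\<sigma> (1 - (1 - y / \<sigma>) exp (-\<i> u / \<sigma>)))^d\<close>, where \<open>u = \<sigma> t\<close>. A local central limit theorem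
  with a polynomial domination (no modularity is required) yields the limit
  \<open>\<integral> exp (-u\<^sup>2 / 2) (y + \<i> u)^d du\<close>, a multiple of the \<open>d\<close>-th Hermite polynomial. As this polynomial
  alternates in sign at \<open>d + 1\<close> points, so does the Jensen polynomial for large \<open>n\<close>, which gives
  \<open>d\<close> distinct real roots.
\<close>

section \<open>The generating function and its coefficients\<close>

text \<open>The divisibility encodes F = 1 + O(X^(n+1)). Multiplying by such a series leaves the
  coefficients up to n unchanged, so closure under products and powers allows whole blocks of
  factors with large exponents to be discarded.\<close>

lemma fps_congr_one_mult:
  fixes F G :: "'a :: field fps"
  assumes "fps_X ^ Suc n dvd F - 1" "fps_X ^ Suc n dvd G - 1"
  shows "fps_X ^ Suc n dvd F * G - 1"
proof -
  have "F * G - 1 = F * (G - 1) + (F - 1)" by (simp add: algebra_simps)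
  thus ?thesis using assms by (metis dvd_add dvd_mult)
qed

lemma fps_congr_one_power:
  fixes F :: "'a :: field fps"
  assumes "fps_X ^ Suc n dvd F - 1"
  shows "fps_X ^ Suc n dvd F ^ r - 1"
proof (induction r)
  case (Suc r)
  show ?case unfolding power_Suc[of F] by (rule fps_congr_one_mult[OF assms Suc])
qed simp

lemma fps_congr_one_prod:
  fixes F :: "'b \<Rightarrow> 'a :: field fps"
  assumes "\<And>i. i \<in> A \<Longrightarrow> fps_X ^ Suc n dvd F i - 1"
  shows "fps_X ^ Suc n dvd prod F A - 1"
  using assms
proof (induction A rule: infinite_finite_induct)
  case (insert x A)
  show ?case unfolding prod.insert[OF insert(1,2)]
    by (intro fps_congr_one_mult) (use insert in auto)
qed auto

lemma fps_one_minus_X_power_inverse: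
  assumes "k > 0"
  shows "(1 - fps_X ^ k) * inverse (1 - fps_X ^ k :: 'a :: field fps) = 1"
  using assms by (intro inverse_mult_eq_1') (simp)

lemma fps_congr_one_X_power:
  assumes "n < k"
  shows "fps_X ^ Suc n dvd (1 - fps_X ^ k :: 'a :: field fps) - 1"
  using assms le_imp_power_dvd[of "Suc n" k "fps_X :: 'a fps"] by simp

lemma fps_congr_one_inverse_X_power:
  assumes "n < k"
  shows "fps_X ^ Suc n dvd inverse (1 - fps_X ^ k :: 'a :: field fps) - 1"
proof -
  have "inverse (1 - fps_X ^ k :: 'a fps) - 1 = fps_X ^ k * inverse (1 - fps_X ^ k)"
    using fps_one_minus_X_power_inverse[of k, where ?'a='a] assms by (simp add: algebra_simps)
  moreover have "fps_X ^ Suc n dvd (fps_X ^ k :: 'a fps)"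
    using assms by (intro le_imp_power_dvd) simp
  ultimately show ?thesis by simp
qed

lemma fps_nth_mult_congr_one:
  fixes F G :: "'a :: field fps"
  assumes "fps_X ^ Suc n dvd G - 1" "m \<le> n"
  shows "fps_nth (F * G) m = fps_nth F m"
proof -
  obtain H where H: "G - 1 = fps_X ^ Suc n * H" using assms(1) by (auto elim: dvdE)
  have "F * G = F + fps_X ^ Suc n * (F * H)"
    using H by (simp add: algebra_simps)
  hence "fps_nth (F * G) m = fps_nth F m + fps_nth (fps_X ^ Suc n * (F * H)) m"
    by (metis fps_add_nth)
  also have "fps_nth (fps_X ^ Suc n * (F * H)) m = 0"
    unfolding fps_X_power_mult_nth using assms(2) by simp
  finally show ?thesis by simp
qed

section \<open>Cancellation of the factors at multiples of \<open>l\<close>\<close>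

text \<open>The part sizes whose denominators survive the cancellation: the coefficients count
  partitions into parts not divisible by \<open>l\<close>, each part in \<open>r\<close> colours.
  The cutoff \<open>J\<close> keeps every product finite.\<close>

definition parts :: "nat \<Rightarrow> nat \<Rightarrow> nat set" where
  "parts l J = {j \<in> {1..J}. \<not> l dvd j}"

lemma finite_parts [simp]: "finite (parts l J)"
  by (simp add: parts_def)

lemma parts_pos: "j \<in> parts l J \<Longrightarrow> j > 0"
  by (auto simp: parts_def)

text \<open>The cutoff may be any \<open>J\<close> above the index, so a single finite product
  serves all the coefficients that enter one Jensen polynomial.\<close>

lemma b_coeff_eq:
  assumes "l > 0" "m \<le> J"
  shows "b_coeff l r m = fps_nth (\<Prod>j\<in>parts l J. inverse (1 - fps_X ^ j) ^ r) m"
proof -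
  have "(\<Prod>j\<in>{1..J}. eta_factor l r j) =
        (\<Prod>j\<in>{1..m}. eta_factor l r j) * (\<Prod>j\<in>{m<..J}. eta_factor l r j)"
    using assms(2)
    by (subst prod.union_disjoint[symmetric]) (auto intro!: prod.cong)
  \<comment> \<open>The cutoff is first raised from \<open>m\<close> to \<open>J\<close>, since the
    additional factors are 1 + O(X^(m+1)).\<close>
  moreover have "fps_X ^ Suc m dvd (\<Prod>j\<in>{m<..J}. eta_factor l r j) - 1"
    unfolding eta_factor_def
  proof (intro fps_congr_one_prod fps_congr_one_power fps_congr_one_mult
               fps_congr_one_X_power fps_congr_one_inverse_X_power)
    fix j assume "j \<in> {m<..J}"
    thus "m < j" by auto
    also have "j \<le> l * j" using assms(1) by simp
    finally show "m < l * j" .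
  qed
  ultimately have "b_coeff l r m = fps_nth (\<Prod>j\<in>{1..J}. eta_factor l r j) m"
    by (simp add: b_coeff_def fps_nth_mult_congr_one)
  also have "(\<Prod>j\<in>{1..J}. eta_factor l r j) =
     ((\<Prod>j\<in>{1..J}. 1 - fps_X ^ (l * j)) * (\<Prod>j\<in>{1..J}. inverse (1 - fps_X ^ j))) ^ r"
    by (simp add: eta_factor_def prod.distrib flip: prod_power_distrib)
  \<comment> \<open>Numerators with \<open>j\<close> up to \<open>J div l\<close> have exponent
    \<open>l * j\<close> at most \<open>J\<close> and cancel against the denominators at multiples
    of \<open>l\<close>; the remaining ones are 1 + O(X^(J+1)).\<close>
  also have "(\<Prod>j\<in>{1..J}. 1 - fps_X ^ (l * j) :: real fps) =
     (\<Prod>j\<in>{1..J div l}. 1 - fps_X ^ (l * j)) * (\<Prod>j\<in>{J div l<..J}. 1 - fps_X ^ (l * j))"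
    by (subst prod.union_disjoint[symmetric])
       (auto intro!: prod.cong intro: order.trans[OF _ div_le_dividend])
  also have "(\<Prod>j\<in>{1..J}. inverse (1 - fps_X ^ j) :: real fps) =
     (\<Prod>j\<in>parts l J. inverse (1 - fps_X ^ j)) * (\<Prod>j\<in>{1..J div l}. inverse (1 - fps_X ^ (l * j)))"
  proof -
    have inj: "inj_on (\<lambda>j. l * j) {1..J div l}" using assms(1) by (auto simp: inj_on_def)
    have "{1..J} = parts l J \<union> (\<lambda>j. l * j) ` {1..J div l}"
    proof (intro equalityI subsetI)
      fix j assume j: "j \<in> {1..J}"
      show "j \<in> parts l J \<union> (\<lambda>j. l * j) ` {1..J div l}"
      proof (cases "l dvd j")
        case True
        then obtain k where k: "j = l * k" by auto
        have "k \<in> {1..J div l}" using j k assms(1)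
          by (auto simp: less_eq_div_iff_mult_less_eq mult.commute intro!: Suc_leI)
        thus ?thesis using k by auto
      qed (use j in \<open>auto simp: parts_def\<close>)
    next
      fix j assume "j \<in> parts l J \<union> (\<lambda>j. l * j) ` {1..J div l}"
      thus "j \<in> {1..J}" using assms(1)
        by (auto simp: parts_def less_eq_div_iff_mult_less_eq mult.commute)
    qed
    moreover have "parts l J \<inter> (\<lambda>j. l * j) ` {1..J div l} = {}"
      by (auto simp: parts_def)
    ultimately show ?thesis
      using prod.union_disjoint[of "parts l J" "(\<lambda>j. l * j) ` {1..J div l}" "\<lambda>j. inverse (1 - fps_X ^ j) :: real fps"]
        prod.reindex[OF inj, of "\<lambda>j. inverse (1 - fps_X ^ j) :: real fps"]
      unfolding o_def by auto
  qed
  also have "(\<Prod>j\<in>{1..J div l}. 1 - fps_X ^ (l * j) :: real fps) * (\<Prod>j\<in>{J div l<..J}. 1 - fps_X ^ (l * j)) *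
      ((\<Prod>j\<in>parts l J. inverse (1 - fps_X ^ j)) * (\<Prod>j\<in>{1..J div l}. inverse (1 - fps_X ^ (l * j)))) =
      (\<Prod>j\<in>parts l J. inverse (1 - fps_X ^ j)) * (\<Prod>j\<in>{J div l<..J}. 1 - fps_X ^ (l * j)) *
      (\<Prod>j\<in>{1..J div l}. (1 - fps_X ^ (l * j)) * inverse (1 - fps_X ^ (l * j)))"
    by (simp add: prod.distrib mult_ac)
  also have "(\<Prod>j\<in>{1..J div l}. (1 - fps_X ^ (l * j)) * inverse (1 - fps_X ^ (l * j)) :: real fps) = 1"
    using assms(1) by (intro prod.neutral ballI fps_one_minus_X_power_inverse) auto
  finally have "b_coeff l r m = fps_nth ((\<Prod>j\<in>parts l J. inverse (1 - fps_X ^ j)) ^ r *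
      (\<Prod>j\<in>{J div l<..J}. 1 - fps_X ^ (l * j)) ^ r) m"
    by (simp add: power_mult_distrib)
  also have "\<dots> = fps_nth ((\<Prod>j\<in>parts l J. inverse (1 - fps_X ^ j)) ^ r) m"
  proof (intro fps_nth_mult_congr_one[of J] fps_congr_one_prod fps_congr_one_power fps_congr_one_X_power)
    fix j assume "j \<in> {J div l<..J}"
    thus "J < l * j" using assms(1)
      by (simp add: div_less_iff_less_mult mult.commute)
  qed (use assms in auto)
  finally show ?thesis by (simp add: prod_power_distrib)
qed

section \<open>Passage to complex series and Cauchy's coefficient formula\<close>

definition fps_complex :: "real fps \<Rightarrow> complex fps" where
  "fps_complex F = Abs_fps (\<lambda>n. of_real (fps_nth F n))"

lemma fps_complex_nth [simp]: "fps_nth (fps_complex F) n = of_real (fps_nth F n)"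
  by (simp add: fps_complex_def)

lemma fps_complex_1 [simp]: "fps_complex 1 = 1"
  by (simp add: fps_eq_iff)

lemma fps_complex_mult [simp]: "fps_complex (F * G) = fps_complex F * fps_complex G"
  by (simp add: fps_eq_iff fps_mult_nth)

lemma fps_complex_power [simp]: "fps_complex (F ^ k) = fps_complex F ^ k"
  by (induction k) auto

lemma fps_complex_prod [simp]: "fps_complex (prod F A) = (\<Prod>x\<in>A. fps_complex (F x))"
  by (induction A rule: infinite_finite_induct) auto

lemma fps_complex_one_minus_X_power [simp]: "fps_complex (1 - fps_X ^ k) = 1 - fps_X ^ k"
  by (simp add: fps_eq_iff fps_X_power_nth)

lemma fps_complex_inverse_one_minus_X_power:
  assumes "k > 0"
  shows "fps_complex (inverse (1 - fps_X ^ k)) = inverse (1 - fps_X ^ k)"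
proof -
  have "(1 - fps_X ^ k) * fps_complex (inverse (1 - fps_X ^ k)) = 1"
    using arg_cong[OF fps_one_minus_X_power_inverse[OF assms], of fps_complex] by simp
  thus ?thesis by (simp add: fps_inverse_unique)
qed

definition gen :: "nat \<Rightarrow> nat \<Rightarrow> nat \<Rightarrow> complex \<Rightarrow> complex" where
  "gen l r J z = (\<Prod>j\<in>parts l J. inverse (1 - z ^ j) ^ r)"

lemma gen_has_fps_expansion:
  "gen l r J has_fps_expansion fps_complex (\<Prod>j\<in>parts l J. inverse (1 - fps_X ^ j) ^ r)"
proof -
  have "(\<lambda>z. \<Prod>j\<in>parts l J. inverse (1 - z ^ j) ^ r) has_fps_expansion
        (\<Prod>j\<in>parts l J. inverse (1 - fps_X ^ j :: complex fps) ^ r)"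
    by (intro fps_expansion_intros) (auto dest: parts_pos)
  also have "(\<Prod>j\<in>parts l J. inverse (1 - fps_X ^ j :: complex fps) ^ r) =
      fps_complex (\<Prod>j\<in>parts l J. inverse (1 - fps_X ^ j) ^ r)"
    by (auto intro!: prod.cong simp: fps_complex_inverse_one_minus_X_power dest: parts_pos)
  finally show ?thesis unfolding gen_def .
qed

lemma one_minus_power_nonzero:
  fixes z :: complex
  assumes "norm z < 1" "j > 0"
  shows "1 - z ^ j \<noteq> 0"
proof
  assume "1 - z ^ j = 0"
  hence "norm (z ^ j) = 1" by (metis eq_iff_diff_eq_0 norm_one)
  thus False using assms power_less_one_iff[of "norm z" j] by (simp add: norm_power)
qed

lemma gen_holomorphic: "gen l r J holomorphic_on ball 0 1"
proof -
  have "(\<lambda>z::complex. inverse (1 - z ^ j) ^ r) holomorphic_on ball 0 1" if "j \<in> parts l J" for j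
    using one_minus_power_nonzero parts_pos[OF that] by (intro holomorphic_intros) simp_all
  thus ?thesis unfolding gen_def by (rule holomorphic_on_prod)
qed

text \<open>Cauchy's formula for the m-th derivative at 0 on the circle of radius
  \<open>exp (-s)\<close>, parametrised by the angle. The interval is centred at 0 because the
  generating function peaks there.\<close>

lemma coefficient_integral:
  fixes s :: real
  assumes f: "f has_fps_expansion F" "f holomorphic_on ball 0 1" and s: "s > 0"
  shows "((\<lambda>\<theta>. f (exp (-s + \<i> * of_real \<theta>)) * exp (of_nat m * (s - \<i> * of_real \<theta>))) has_integral
          of_real (2 * pi) * fps_nth F m) {-pi..pi}"
proof -
  define \<rho> where "\<rho> = exp (-s)"
  have \<rho>: "0 < \<rho>" "\<rho> < 1" using s by (auto simp: \<rho>_def)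
  have sub: "cball 0 \<rho> \<subseteq> ball (0::complex) 1" using \<rho> by auto
  have F: "fps_nth F m = (deriv ^^ m) f 0 / fact m"
    using fps_nth_fps_expansion[of f F m] f(1) by simp
  have "((\<lambda>u. f u / (u - 0) ^ Suc m) has_contour_integral
      (2 * pi * \<i>) / fact m * (deriv ^^ m) f 0) (circlepath 0 \<rho>)"
    using \<rho> f(2) sub
    by (intro Cauchy_has_contour_integral_higher_derivative_circlepath)
       (auto intro: holomorphic_on_subset holomorphic_on_imp_continuous_on)
  \<comment> \<open>The circle is restarted half a turn later, so that the angle runs from
    \<open>-pi\<close> to \<open>pi\<close> instead of from 0 to \<open>2 * pi\<close>; this amounts
    to replacing the radius by its negative.\<close>
  hence "((\<lambda>u. f u / u ^ Suc m) has_contour_integral 2 * pi * \<i> * fps_nth F m)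
           (shiftpath (1/2) (circlepath 0 \<rho>))"
    by (intro has_contour_integral_shiftpath) (simp_all add: F)
  moreover have "shiftpath (1/2) (circlepath 0 \<rho>) = circlepath 0 (-\<rho>)"
  proof
    fix x :: real
    show "shiftpath (1/2) (circlepath 0 \<rho>) x = circlepath 0 (-\<rho>) x"
      using circlepath_add_half[of 0 \<rho> x] unfolding shiftpath_def circlepath_minus
      by (simp add: add.commute)
  qed
  ultimately have ci: "((\<lambda>u. f u / u ^ Suc m) has_contour_integral 2 * pi * \<i> * fps_nth F m)
      (circlepath 0 (-\<rho>))" by simp
  define h where "h = (\<lambda>\<theta>::real. f (exp (-s + \<i> * of_real \<theta>)) * exp (of_nat m * (s - \<i> * of_real \<theta>)))"
  have cp: "circlepath 0 (-\<rho>) x = exp (-s + \<i> * of_real (2 * pi * x + - pi))" for x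
  proof -
    have "-s + \<i> * of_real (2 * pi * x + - pi) = of_real (-s) + 2 * of_real pi * \<i> * of_real x - \<i> * of_real pi"
      by (simp add: algebra_simps)
    also have "exp \<dots> = of_real \<rho> * exp (2 * of_real pi * \<i> * of_real x) / exp (\<i> * of_real pi)"
      unfolding exp_diff exp_add exp_of_real \<rho>_def ..
    also have "\<dots> = circlepath 0 (-\<rho>) x"
      by (simp add: circlepath)
    finally show ?thesis ..
  qed
  have "((\<lambda>x. 2 * pi * \<i> * h (2 * pi * x + - pi)) has_integral 2 * pi * \<i> * fps_nth F m) {0..1}"
  proof (rule has_integral_eq[OF _ ci[unfolded has_contour_integral]])
    fix x :: real assume x: "x \<in> {0..1}"
    define w where "w = -s + \<i> * of_real (2 * pi * x + - pi)"
    have cpw: "circlepath 0 (-\<rho>) x = exp w" unfolding w_def by (rule cp)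
    have "vector_derivative (circlepath 0 (-\<rho>)) (at x) = 2 * pi * \<i> * circlepath 0 (-\<rho>) x"
      using vector_derivative_circlepath[of 0 "-\<rho>" x] fun_cong[OF circlepath[of 0 "-\<rho>"], of x] by simp
    hence vd: "vector_derivative (circlepath 0 (-\<rho>)) (at x) = 2 * pi * \<i> * exp w"
      unfolding cpw .
    have "f (exp w) / exp w ^ Suc m * (2 * pi * \<i> * exp w) = 2 * pi * \<i> * (f (exp w) / exp w ^ m)"
      by (simp add: field_simps)
    also have "f (exp w) / exp w ^ m = f (exp w) * exp (of_nat m * (-w))"
      using exp_of_nat_mult[of m w] by (simp add: exp_minus divide_inverse)
    also have "\<dots> = h (2 * pi * x + - pi)" by (simp add: h_def w_def)
    finally show "f (circlepath 0 (- \<rho>) x) / circlepath 0 (- \<rho>) x ^ Suc m *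
         vector_derivative (circlepath 0 (- \<rho>)) (at x) =
         2 * pi * \<i> * h (2 * pi * x + - pi)"
      unfolding vd cpw .
  qed
  note int = this
  have inv: "inverse c * (c * w) = w" if "c \<noteq> 0" for c w :: complex
    using that by simp
  have "inverse (2 * pi * \<i>) * (2 * pi * \<i> * w) = w" for w
    by (rule inv) simp
  with has_integral_mult_right[OF int, of "inverse (2 * pi * \<i>)"]
  have "((\<lambda>x. h (2 * pi * x + - pi)) has_integral fps_nth F m) {0..1}"
    by (simp only:)
  hence "(h has_integral of_real (2 * pi) * fps_nth F m) {-pi..pi}"
    using has_integral_affinity_iff[of "2 * pi" h "-pi" "of_real (2 * pi) * fps_nth F m" "-pi" pi]
    by (simp add: scaleR_conv_of_real mult.assoc[symmetric])
  thus ?thesis unfolding h_def .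
qed

section \<open>Hermite polynomials and sign changes\<close>

text \<open>The moments of a standard Gaussian, times powers of the imaginary unit.\<close>

fun herm_coeff :: "nat \<Rightarrow> real" where
  "herm_coeff 0 = 1"
| "herm_coeff (Suc 0) = 0"
| "herm_coeff (Suc (Suc k)) = - real (Suc k) * herm_coeff k"

text \<open>The probabilists' Hermite polynomial, written as the expectation of (y + iZ)^d for a
  standard normal Z, which is the shape in which the limit integral produces it.\<close>

definition herm :: "nat \<Rightarrow> real poly" where
  "herm d = (\<Sum>k\<le>d. monom (real (d choose k) * herm_coeff k) (d - k))"

lemma coeff_herm: "coeff (herm d) m = (if m \<le> d then real (d choose m) * herm_coeff (d - m) else 0)"
proof -
  have "coeff (herm d) m = (\<Sum>k\<le>d. if d - k = m then real (d choose k) * herm_coeff k else 0)"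
    by (simp add: herm_def coeff_sum)
  also have "\<dots> = (\<Sum>k\<in>(if m \<le> d then {d - m} else {}). real (d choose k) * herm_coeff k)"
    by (rule sum.mono_neutral_cong_right) (auto split: if_splits)
  also have "\<dots> = (if m \<le> d then real (d choose m) * herm_coeff (d - m) else 0)"
    using binomial_symmetric[of m d] by auto
  finally show ?thesis .
qed

lemma herm_0: "herm 0 = 1"
  by (simp add: herm_def)

text \<open>Compared coefficientwise: Pascal's rule splits the left side, one summand belonging to
  the shifted polynomial and the other to the derivative.\<close>

lemma herm_Suc: "herm (Suc d) = [:0, 1:] * herm d - pderiv (herm d)"
proof (rule poly_eqI)
  fix m
  \<comment> \<open>The recursion of \<open>herm_coeff\<close> supplies the factor d - m, which the
    absorption identity (d - m) C(d, m) = (m + 1) C(d, m + 1) turns into the factor of the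
    derivative.\<close>
  have key: "real (d choose m) * herm_coeff (Suc (d - m)) = - (real (Suc m) * (real (d choose Suc m) * herm_coeff (d - Suc m)))"
    if "m < d"
  proof -
    obtain k where k: "d - m = Suc k" using \<open>m < d\<close> by (metis Suc_diff_Suc)
    have "(d - m) * (d choose m) = Suc m * (d choose Suc m)"
      using binomial_absorb_comp[of d m] binomial_absorption[of m d] by simp
    hence "real (Suc k) * real (d choose m) = real (Suc m) * real (d choose Suc m)"
      unfolding k of_nat_mult[symmetric] by simp
    moreover have "d - Suc m = k" using k by simp
    ultimately show ?thesis unfolding k herm_coeff.simps by (simp only: mult_ac mult_minus_left mult_minus_right)
  qed
  show "coeff (herm (Suc d)) m = coeff ([:0, 1:] * herm d - pderiv (herm d)) m"
  proof (cases m)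
    case 0
    show ?thesis
    proof (cases d)
      case (Suc e)
      thus ?thesis using 0 key[of] by (auto simp: coeff_herm coeff_pderiv)
    qed (use 0 in \<open>simp add: coeff_herm coeff_pderiv\<close>)
  next
    case (Suc i)
    consider "m < d" | "m = d" | "m = Suc d" | "m > Suc d" by linarith
    thus ?thesis
    proof cases
      case 1
      hence *: "Suc d - m = Suc (d - m)" "d - i = Suc (d - m)" using Suc by auto
      have "real (Suc d choose m) = real (d choose i) + real (d choose m)"
        using Suc by simp
      thus ?thesis using 1 Suc * key[OF 1] by (simp add: coeff_herm coeff_pderiv algebra_simps)
    next
      case 2
      hence "d - i = 1" "Suc d - m = 1" using Suc by auto
      thus ?thesis using 2 Suc by (simp add: coeff_herm coeff_pderiv coeff_pCons split: nat.splits)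
    qed (use Suc in \<open>auto simp: coeff_herm coeff_pderiv\<close>)
  qed
qed

section \<open>From alternating signs to real roots\<close>

text \<open>There are n + 1 points and the sign at the last one is positive, the pattern of a degree
  n polynomial with positive leading coefficient. Finitely many strict inequalities at fixed points
  are stable under pointwise limits.\<close>

definition alternates :: "nat \<Rightarrow> (nat \<Rightarrow> real) \<Rightarrow> (real \<Rightarrow> real) \<Rightarrow> bool" where
  "alternates n y f \<longleftrightarrow> (\<forall>i<n. y i < y (Suc i)) \<and> (\<forall>i\<le>n. (-1) ^ (n + i) * f (y i) > 0)"

lemma gaussian_poly_tendsto_0:
  fixes p :: "real poly"
  shows "((\<lambda>y. poly p y * exp (- y\<^sup>2 / 2)) \<longlongrightarrow> 0) at_top"
proof -
  have "((\<lambda>y. coeff p i * (y ^ i * exp (- y\<^sup>2 / 2))) \<longlongrightarrow> coeff p i * 0) at_top" for i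
    by (intro tendsto_mult tendsto_const) real_asymp
  hence "((\<lambda>y. \<Sum>i\<le>degree p. coeff p i * (y ^ i * exp (- y\<^sup>2 / 2))) \<longlongrightarrow> (\<Sum>i\<le>degree p. coeff p i * 0)) at_top"
    by (intro tendsto_sum)
  thus ?thesis by (simp add: poly_altdef sum_distrib_right mult.assoc)
qed

lemma gaussian_poly_tendsto_0_bot:
  fixes p :: "real poly"
  shows "((\<lambda>y. poly p y * exp (- y\<^sup>2 / 2)) \<longlongrightarrow> 0) at_bot"
proof -
  have "((\<lambda>y. poly p (-y) * exp (- y\<^sup>2 / 2)) \<longlongrightarrow> 0) at_top"
    using gaussian_poly_tendsto_0[of "pcompose p [:0, -1:]"] by (simp add: poly_pcompose)
  thus ?thesis unfolding at_bot_mirror filterlim_filtermap by simp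
qed

text \<open>\<open>herm (Suc n) * exp (- y\<^sup>2 / 2)\<close> is minus the derivative of \<open>herm n * exp (- y\<^sup>2 / 2)\<close>, which
  vanishes at infinity; so Rolle's argument gains one sign change.\<close>

lemma herm_alternates: "\<exists>y. alternates n y (poly (herm n))"
proof (induction n)
  case 0
  show ?case by (auto simp: alternates_def herm_0)
next
  case (Suc n)
  then obtain y where y: "\<And>i. i < n \<Longrightarrow> y i < y (Suc i)"
     "\<And>i. i \<le> n \<Longrightarrow> (-1) ^ (n + i) * poly (herm n) (y i) > 0"
    by (auto simp: alternates_def)
  define g where "g = (\<lambda>y. poly (herm n) y * exp (- y\<^sup>2 / 2))"
  have deriv: "(g has_real_derivative - (poly (herm (Suc n)) y * exp (- y\<^sup>2 / 2))) (at y)" for y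
    unfolding g_def herm_Suc
    by (auto intro!: derivative_eq_intros poly_DERIV simp: algebra_simps)
  have mvt: "\<exists>z>a. z < b \<and> c * poly (herm (Suc n)) z > 0" if ab: "a < b" and c: "c * g b < c * g a" for a b c
  proof -
    obtain z where z: "a < z" "z < b" "g b - g a = (b - a) * - (poly (herm (Suc n)) z * exp (- z\<^sup>2 / 2))"
      using MVT2[OF ab deriv] by blast
    have "0 < c * (g a - g b)" using c by (simp add: algebra_simps)
    also have "\<dots> = ((b - a) * exp (- z\<^sup>2 / 2)) * (c * poly (herm (Suc n)) z)"
    proof -
      have "g a - g b = (b - a) * (poly (herm (Suc n)) z * exp (- z\<^sup>2 / 2))" using z(3) by simp
      thus ?thesis by (simp only: mult_ac)
    qed
    finally have "c * poly (herm (Suc n)) z > 0" using ab by (auto elim: zero_less_mult_pos)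
    thus ?thesis using z(1,2) by blast
  qed
  have gpos: "(-1) ^ (n + i) * g (y i) > 0" if "i \<le> n" for i
    using y(2)[OF that] unfolding g_def by (simp flip: mult.assoc)
  \<comment> \<open>The points \<open>a\<close> and \<open>b\<close> replace minus and plus
    infinity: there \<open>g\<close> is smaller in modulus than at the outermost alternation
    points.\<close>
  have "eventually (\<lambda>x. norm (g x) < \<bar>g (y 0)\<bar>) at_bot"
    using gaussian_poly_tendsto_0_bot[of "herm n"] gpos[of 0] unfolding g_def
    by (intro order_tendstoD(2)[OF tendsto_norm_zero]) auto
  hence "eventually (\<lambda>x. norm (g x) < \<bar>g (y 0)\<bar> \<and> x < y 0) at_bot"
    by (intro eventually_conj eventually_gt_at_bot)
  then obtain a where a: "norm (g a) < \<bar>g (y 0)\<bar>" "a < y 0"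
    using eventually_happens'[OF trivial_limit_at_bot_linorder] by blast
  have "eventually (\<lambda>x. norm (g x) < \<bar>g (y n)\<bar>) at_top"
    using gaussian_poly_tendsto_0[of "herm n"] gpos[of n] unfolding g_def
    by (intro order_tendstoD(2)[OF tendsto_norm_zero]) auto
  hence "eventually (\<lambda>x. norm (g x) < \<bar>g (y n)\<bar> \<and> x > y n) at_top"
    by (intro eventually_conj eventually_gt_at_top)
  then obtain b where b: "norm (g b) < \<bar>g (y n)\<bar>" "b > y n"
    using eventually_happens'[OF trivial_limit_at_top_linorder] by blast
  \<comment> \<open>The old points move up by one index to make room for \<open>a\<close>. The n + 3
    points of \<open>Y\<close> bound n + 2 gaps, and the mean value theorem yields one new
    alternation point in each.\<close>
  define Y where "Y = (\<lambda>i. if i = 0 then a else if i \<le> Suc n then y (i - 1) else b)"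
  have Y: "Y i < Y (Suc i) \<and> (-1) ^ (Suc n + i) * g (Y (Suc i)) < (-1) ^ (Suc n + i) * g (Y i)"
    if i: "i \<le> Suc n" for i
  proof -
    consider "i = 0" | "0 < i" "i \<le> n" | "i = Suc n" using i by linarith
    thus ?thesis
    proof cases
      case 1
      show ?thesis using a gpos[of 0] 1 by (cases "even n") (auto simp: Y_def)
    next
      case 2
      then obtain j where j: "i = Suc j" by (cases i) auto
      show ?thesis using gpos[of j] gpos[of i] y(1)[of j] 2 j
        by (cases "even (n + j)") (auto simp: Y_def)
    next
      case 3
      show ?thesis using b gpos[of n] 3 by (auto simp: Y_def)
    qed
  qed
  have "\<exists>z>Y i. z < Y (Suc i) \<and> (-1) ^ (Suc n + i) * poly (herm (Suc n)) z > 0" if "i \<le> Suc n" for i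
    using mvt[of "Y i" "Y (Suc i)" "(-1) ^ (Suc n + i)"] Y[OF that] by blast
  then obtain z where z: "\<And>i. i \<le> Suc n \<Longrightarrow> Y i < z i \<and> z i < Y (Suc i) \<and> (-1) ^ (Suc n + i) * poly (herm (Suc n)) (z i) > 0"
    by metis
  have "alternates (Suc n) z (poly (herm (Suc n)))"
    unfolding alternates_def
  proof (intro conjI allI impI)
    fix i assume "i < Suc n"
    thus "z i < z (Suc i)" using z[of i] z[of "Suc i"] by linarith
  qed (use z in blast)
  thus ?case by blast
qed

text \<open>The intermediate value theorem gives a root strictly inside each of the \<open>d\<close>
  gaps, and distinct gaps are disjoint.\<close>

lemma alternates_roots:
  assumes alt: "alternates d y f" and cont: "continuous_on UNIV f"
  shows "\<exists>z. inj_on z {..<d} \<and> (\<forall>i<d. f (z i) = 0)"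
proof -
  have y: "\<And>i. i < d \<Longrightarrow> y i < y (Suc i)" "\<And>i. i \<le> d \<Longrightarrow> (-1) ^ (d + i) * f (y i) > 0"
    using alt by (auto simp: alternates_def)
  have "\<exists>z>y i. z < y (Suc i) \<and> f z = 0" if i: "i < d" for i
  proof -
    have "f (y i) * f (y (Suc i)) < 0"
      using y(2)[of i] y(2)[of "Suc i"] i
      by (cases "even (d + i)") (auto simp: mult_less_0_iff)
    hence "(f (y i) \<le> 0 \<and> 0 \<le> f (y (Suc i)) \<or> f (y (Suc i)) \<le> 0 \<and> 0 \<le> f (y i)) \<and> f (y i) \<noteq> 0 \<and> f (y (Suc i)) \<noteq> 0"
      by (auto simp: mult_less_0_iff)
    moreover have "continuous_on {y i..y (Suc i)} f" using cont continuous_on_subset by blast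
    ultimately obtain z where "y i \<le> z" "z \<le> y (Suc i)" "f z = 0" "f (y i) \<noteq> 0" "f (y (Suc i)) \<noteq> 0"
      using IVT'[of f "y i" 0 "y (Suc i)"] IVT2'[of f "y (Suc i)" 0 "y i"] y(1)[OF i] by fastforce
    thus ?thesis by (metis order_le_less)
  qed
  then obtain z where z: "\<And>i. i < d \<Longrightarrow> y i < z i \<and> z i < y (Suc i) \<and> f (z i) = 0" by metis
  have ymono: "y i \<le> y j" if "i \<le> j" "j \<le> d" for i j
    using that by (induction j rule: dec_induct) (auto dest!: y(1) Suc_le_lessD)
  have "z i < z j" if "i < j" "j < d" for i j
    using z[of i] z[of j] ymono[of "Suc i" j] that by force
  hence "inj_on z {..<d}" by (metis inj_onI lessThan_iff less_irrefl linorder_neqE_nat)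
  thus ?thesis using z by blast
qed

text \<open>A nonzero polynomial of degree at most \<open>d\<close> has at most \<open>d\<close>
  roots, so the given real ones are all of them.\<close>

lemma hyperbolic_if_real_roots:
  fixes p :: "complex poly" and z :: "nat \<Rightarrow> real"
  assumes "degree p \<le> d" "p \<noteq> 0" "inj_on z {..<d}" "\<And>i. i < d \<Longrightarrow> poly p (of_real (z i)) = 0"
  shows "hyperbolic p"
proof -
  let ?R = "(\<lambda>i. complex_of_real (z i)) ` {..<d}"
  have fin: "finite {w. poly p w = 0}" using assms(2) by (rule poly_roots_finite)
  have "inj_on (\<lambda>i. complex_of_real (z i)) {..<d}" using assms(3) by (auto simp: inj_on_def)
  hence "card ?R = d" by (simp add: card_image)
  moreover have sub: "?R \<subseteq> {w. poly p w = 0}" using assms(4) by auto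
  moreover have "card {w. poly p w = 0} \<le> d"
    using card_poly_roots_bound[OF assms(2)] assms(1) by linarith
  ultimately have "?R = {w. poly p w = 0}" using card_seteq[OF fin sub] by simp
  thus ?thesis using assms(2) unfolding hyperbolic_def by (force simp: set_eq_iff)
qed

lemma tendsto_alternates:
  fixes F :: "'a \<Rightarrow> real \<Rightarrow> real"
  assumes "alternates d y f" "\<And>i. i \<le> d \<Longrightarrow> ((\<lambda>n. F n (y i)) \<longlongrightarrow> f (y i)) A"
  shows "eventually (\<lambda>n. alternates d y (F n)) A"
proof -
  have "eventually (\<lambda>n. (-1) ^ (d + i) * F n (y i) > 0) A" if "i \<le> d" for i
    using that assms by (intro order_tendstoD(1)[of _ "(-1) ^ (d + i) * f (y i)"] tendsto_intros)
      (auto simp: alternates_def)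
  hence "eventually (\<lambda>n. \<forall>i\<in>{..d}. (-1) ^ (d + i) * F n (y i) > 0) A"
    by (intro eventually_ball_finite) auto
  thus ?thesis by eventually_elim (use assms(1) in \<open>auto simp: alternates_def\<close>)
qed

section \<open>Bounds for the characteristic function\<close>

text \<open>The characteristic function at \<open>a\<close> of a geometric variable that takes the
  value k with probability (1 - x) x^k.\<close>

definition qfac :: "real \<Rightarrow> real \<Rightarrow> complex" where
  "qfac x a = (1 - of_real x) / (1 - of_real x * cis a)"

definition char_fun :: "nat \<Rightarrow> nat \<Rightarrow> nat \<Rightarrow> real \<Rightarrow> real \<Rightarrow> complex" where
  "char_fun l r J s t = (\<Prod>j\<in>parts l J. qfac (exp (-(s * real j))) (real j * t) ^ r)"

lemma norm_qfac:
  assumes "0 < x" "x < 1"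
  shows "(norm (qfac x a))\<^sup>2 = 1 / (1 + 2 * x * (1 - cos a) / (1 - x)\<^sup>2)"
proof -
  have "(norm (1 - of_real x * cis a))\<^sup>2 = (1 - x * cos a)\<^sup>2 + (x * sin a)\<^sup>2"
    by (simp add: cmod_power2)
  also have "\<dots> = (1 - x)\<^sup>2 + 2 * x * (1 - cos a)"
    using sin_cos_squared_add[of a] by algebra
  finally have *: "(norm (1 - of_real x * cis a))\<^sup>2 = (1 - x)\<^sup>2 + 2 * x * (1 - cos a)" .
  have "norm (1 - of_real x :: complex) = 1 - x"
    using assms by (metis abs_of_nonneg diff_ge_0_iff_ge less_imp_le norm_of_real of_real_1 of_real_diff)
  hence "(norm (qfac x a))\<^sup>2 = (1 - x)\<^sup>2 / ((1 - x)\<^sup>2 + 2 * x * (1 - cos a))"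
    by (simp add: qfac_def norm_divide power_divide *)
  also have "\<dots> = 1 / (1 + 2 * x * (1 - cos a) / (1 - x)\<^sup>2)"
    using assms by (simp add: divide_simps)
  finally show ?thesis .
qed

lemma norm_qfac_le_1:
  assumes "0 < x" "x < 1"
  shows "norm (qfac x a) \<le> 1"
proof -
  have "2 * x * (1 - cos a) / (1 - x)\<^sup>2 \<ge> 0" using assms by simp
  hence "1 / (1 + 2 * x * (1 - cos a) / (1 - x)\<^sup>2) \<le> 1" by simp
  hence "(norm (qfac x a))\<^sup>2 \<le> 1\<^sup>2" using norm_qfac[OF assms] by simp
  thus ?thesis by (rule power2_le_imp_le) simp
qed

text \<open>Two monotonicity arguments: on [0, 1] the cosine is at least cos (pi / 3) = 1/2, hence
  sin u >= u / 2, and integrating once more gives the claim.\<close>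

lemma one_minus_cos_ge:
  fixes t :: real
  assumes "\<bar>t\<bar> \<le> 1"
  shows "1 - cos t \<ge> t\<^sup>2 / 4"
proof -
  define x where "x = \<bar>t\<bar>"
  have x: "0 \<le> x" "x \<le> 1" using assms by (auto simp: x_def)
  have sin: "sin u - u / 2 \<ge> 0" if u: "0 \<le> u" "u \<le> 1" for u :: real
  proof -
    have "sin 0 - 0 / 2 \<le> sin u - u / 2"
    proof (rule DERIV_nonneg_imp_nondecreasing[OF u(1)])
      fix v :: real assume v: "0 \<le> v" "v \<le> u"
      have "cos (pi / 3) \<le> cos v" using v u pi_gt3 by (intro cos_monotone_0_pi_le) auto
      moreover have "((\<lambda>v. sin v - v / 2) has_real_derivative cos v - 1 / 2) (at v)"
        by (auto intro!: derivative_eq_intros)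
      ultimately show "\<exists>y. ((\<lambda>v. sin v - v / 2) has_real_derivative y) (at v) \<and> 0 \<le> y"
        by (intro exI[of _ "cos v - 1 / 2"]) (simp add: cos_60)
    qed
    thus ?thesis by simp
  qed
  have "1 - cos 0 - 0\<^sup>2 / 4 \<le> 1 - cos x - x\<^sup>2 / 4"
  proof (rule DERIV_nonneg_imp_nondecreasing[OF x(1)])
    fix v :: real assume v: "0 \<le> v" "v \<le> x"
    have "((\<lambda>v. 1 - cos v - v\<^sup>2 / 4) has_real_derivative sin v - v / 2) (at v)"
      by (auto intro!: derivative_eq_intros)
    thus "\<exists>y. ((\<lambda>v. 1 - cos v - v\<^sup>2 / 4) has_real_derivative y) (at v) \<and> 0 \<le> y"
      using sin[of v] v x by (intro exI[of _ "sin v - v / 2"]) simp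
  qed
  thus ?thesis by (simp add: x_def)
qed

text \<open>For y in (0, 1] one has exp (-y) >= 1/3 and 1 - exp (-y) <= y, which replaces the exact
  formula for the modulus by one in which y enters only through y^2.\<close>

lemma norm_qfac_le:
  assumes "0 < y" "y \<le> 1"
  shows "(norm (qfac (exp (-y)) a))\<^sup>2 \<le> 1 / (1 + 2 / 3 * ((1 - cos a) / y\<^sup>2))"
proof -
  define x where "x = exp (-y)"
  have x: "0 < x" "x < 1" using assms by (auto simp: x_def)
  have "exp y \<le> exp 1" using assms by simp
  also have "\<dots> < 3" using e_less_272 by simp
  finally have x3: "1 / 3 \<le> x" by (simp add: x_def exp_minus field_simps)
  have "1 - x \<le> y" unfolding x_def using exp_ge_add_one_self[of "-y"] by simp
  hence "(1 - x)\<^sup>2 \<le> y\<^sup>2" using x by (intro power_mono) auto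
  hence "2 / 3 * ((1 - cos a) / y\<^sup>2) \<le> 2 * x * ((1 - cos a) / (1 - x)\<^sup>2)"
    using x x3 assms by (intro mult_mono divide_left_mono) auto
  hence "1 / (1 + 2 * x * (1 - cos a) / (1 - x)\<^sup>2) \<le> 1 / (1 + 2 / 3 * ((1 - cos a) / y\<^sup>2))"
    using assms by (intro divide_left_mono mult_pos_pos add_pos_nonneg) (use x in auto)
  thus ?thesis unfolding norm_qfac[OF x, of a] x_def[symmetric] .
qed

text \<open>All factors have modulus at most 1, so dropping factors and lowering the exponent
  \<open>r\<close> to 1 can only enlarge the product. Decay therefore only has to be extracted from
  a convenient set \<open>B\<close> of parts.\<close>

lemma norm_char_fun_le_prod:
  assumes "B \<subseteq> parts l J" "r \<ge> 1" "s > 0"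
  shows "(norm (char_fun l r J s t))\<^sup>2 \<le> (\<Prod>j\<in>B. (norm (qfac (exp (-(s * real j))) (real j * t)))\<^sup>2)"
proof -
  let ?q = "\<lambda>j. norm (qfac (exp (-(s * real j))) (real j * t))"
  have q: "?q j \<le> 1" if "j \<in> parts l J" for j
    using assms(3) parts_pos[OF that] by (intro norm_qfac_le_1) auto
  have "norm (char_fun l r J s t) = (\<Prod>j\<in>parts l J. ?q j ^ r)"
    by (simp add: char_fun_def norm_power flip: prod_norm)
  also have "\<dots> = (\<Prod>j\<in>B. ?q j ^ r) * (\<Prod>j\<in>parts l J - B. ?q j ^ r)"
    using prod.subset_diff[OF assms(1)] by (simp add: mult.commute)
  also have "\<dots> \<le> (\<Prod>j\<in>B. ?q j) * 1"
  proof (intro mult_mono prod_mono prod_le_1 conjI)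
    fix j assume "j \<in> B"
    thus "?q j ^ r \<le> ?q j" using q[of j] assms(1,2) power_decreasing[of 1 r "?q j"] by auto
  qed (use q assms(1) in \<open>auto intro!: prod_nonneg power_le_one\<close>)
  finally have "(norm (char_fun l r J s t))\<^sup>2 \<le> (\<Prod>j\<in>B. ?q j)\<^sup>2"
    by (intro power_mono) auto
  thus ?thesis by (simp add: prod_power_distrib)
qed

section \<open>Decay near and away from the origin\<close>

text \<open>Numbers congruent to 1 modulo \<open>l\<close> are never divisible by \<open>l\<close>,
  so this progression supplies at least 1 / (2 l u) admissible parts of size at most 1 / u. Half of
  the bound 1 pays for \<open>i * l\<close>, the other half for the summand 1.\<close>

lemma progression_subset_parts:
  assumes l: "l \<ge> 2" and u: "0 < u" "u \<le> 1 / 2" and J: "1 / u \<le> real J"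
  defines "M \<equiv> nat \<lceil>1 / (2 * real l * u)\<rceil>"
  shows "(\<lambda>i. i * l + 1) ` {..<M} \<subseteq> parts l J"
    and "\<And>i. i < M \<Longrightarrow> real (i * l + 1) * u \<le> 1"
    and "1 / (2 * real l * u) \<le> real M"
    and "inj_on (\<lambda>i. i * l + 1) {..<M}"
proof -
  show *: "real (i * l + 1) * u \<le> 1" if "i < M" for i
  proof -
    have "int i < \<lceil>1 / (2 * real l * u)\<rceil>" using that unfolding M_def by linarith
    hence "real i < 1 / (2 * real l * u)" by (simp add: less_ceiling_iff)
    hence "real i * l * u < 1 / 2" using l u by (simp add: field_simps)
    thus ?thesis using u by (simp add: algebra_simps)
  qed
  show "(\<lambda>i. i * l + 1) ` {..<M} \<subseteq> parts l J"
  proof (rule image_subsetI)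
    fix i assume "i \<in> {..<M}"
    hence "real (i * l + 1) \<le> 1 / u" using *[of i] u by (simp add: field_simps)
    hence "real (i * l + 1) \<le> real J" using J by linarith
    hence "i * l + 1 \<le> J" by (simp only: of_nat_le_iff)
    moreover have "\<not> l dvd i * l + 1"
    proof
      assume "l dvd i * l + 1"
      hence "l dvd 1" by (metis dvd_add_right_iff dvd_triv_right)
      thus False using l by simp
    qed
    ultimately show "i * l + 1 \<in> parts l J" by (simp add: parts_def)
  qed
  show "1 / (2 * real l * u) \<le> real M" unfolding M_def by linarith
  show "inj_on (\<lambda>i. i * l + 1) {..<M}" using l by (auto simp: inj_on_def)
qed

text \<open>Since \<open>u\<close> dominates both \<open>s\<close> and the modulus of
  \<open>t\<close>, each part j <= 1 / u satisfies s j <= 1 and |j t| <= 1. Its factor then has a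
  bound free of j, and there are about 1 / (l u) such parts.\<close>

lemma char_fun_bound_near:
  assumes l: "l \<ge> 2" and r: "r \<ge> 1" and K: "K \<ge> 1" and s: "0 < s" "1 / s \<le> real J"
    and u: "s \<le> u" "\<bar>t\<bar> \<le> u" "u \<le> 1 / (4 * real l * real K)"
  shows "(norm (char_fun l r J s t))\<^sup>2 \<le> 1 / (1 + t\<^sup>2 / (24 * real l * real K * s\<^sup>2 * u)) ^ K"
proof -
  define M where "M = nat \<lceil>1 / (2 * real l * u)\<rceil>"
  \<comment> \<open>The squares of j cancel in (2/3) ((j t)^2 / 4) / (s j)^2, which leaves this
    value.\<close>
  define a where "a = t\<^sup>2 / (6 * s\<^sup>2)"
  have u0: "u > 0" using s u by linarith
  have "1 * 1 \<le> real l * real K" using l K by (intro mult_mono) auto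
  hence "1 / (4 * real l * real K) \<le> 1 / 2" by (simp add: field_simps)
  hence u1: "u \<le> 1 / 2" using u by linarith
  have "1 / u \<le> 1 / s" using u s by (simp add: frac_le)
  hence "1 / u \<le> real J" using s by linarith
  note B = progression_subset_parts[OF l u0 u1 this, folded M_def]
  have "(norm (char_fun l r J s t))\<^sup>2 \<le>
      (\<Prod>j\<in>(\<lambda>i. i * l + 1) ` {..<M}. (norm (qfac (exp (-(s * real j))) (real j * t)))\<^sup>2)"
    by (rule norm_char_fun_le_prod[OF B(1) r s(1)])
  also have "\<dots> \<le> (\<Prod>j\<in>(\<lambda>i. i * l + 1) ` {..<M}. 1 / (1 + a))"
  proof (intro prod_mono conjI)
    fix j assume "j \<in> (\<lambda>i. i * l + 1) ` {..<M}"
    then obtain i where i: "i < M" "j = i * l + 1" by auto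
    have j: "j > 0" using i by simp
    have ju: "real j * u \<le> 1" using B(2)[OF i(1)] i(2) by simp
    have "real j * s \<le> real j * u" using u by (intro mult_left_mono) auto
    hence "s * real j \<le> 1" using ju by (simp add: mult.commute)
    hence sj: "0 < s * real j" "s * real j \<le> 1" using s j by simp_all
    have "real j * \<bar>t\<bar> \<le> real j * u" using u by (intro mult_left_mono) auto
    hence "\<bar>real j * t\<bar> \<le> 1" using ju by (simp add: abs_mult)
    from one_minus_cos_ge[OF this]
    have "2 / 3 * ((1 - cos (real j * t)) / (s * real j)\<^sup>2) \<ge> 2 / 3 * (((real j * t)\<^sup>2 / 4) / (s * real j)\<^sup>2)"
      by (intro mult_left_mono divide_right_mono) auto
    also have "2 / 3 * (((real j * t)\<^sup>2 / 4) / (s * real j)\<^sup>2) = a"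
      using j s by (simp add: a_def power_mult_distrib)
    finally have "1 / (1 + 2 / 3 * ((1 - cos (real j * t)) / (s * real j)\<^sup>2)) \<le> 1 / (1 + a)"
      by (intro divide_left_mono mult_pos_pos) (auto simp: a_def add_pos_nonneg)
    thus "(norm (qfac (exp (-(s * real j))) (real j * t)))\<^sup>2 \<le> 1 / (1 + a)"
      using norm_qfac_le[OF sj, of "real j * t"] by linarith
  qed auto
  also have "\<dots> = 1 / (1 + a) ^ M"
    using card_image[OF B(4)] by (simp add: power_one_over)
  also have "\<dots> \<le> 1 / (1 + t\<^sup>2 / (24 * real l * real K * s\<^sup>2 * u)) ^ K"
  proof (rule divide_left_mono)
    \<comment> \<open>The \<open>M\<close> equal factors are grouped into \<open>K\<close> blocks of
      length \<open>q\<close>, and Bernoulli's inequality is applied to each block. As M >= 2 K,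
      rounding costs at most a factor 2, hence 24 = 4 * 6.\<close>
    define q where "q = M div K"
    have a0: "a \<ge> 0" by (simp add: a_def)
    have "2 * K \<le> 1 / (2 * real l * u)" using u(3) u0 l K by (simp add: field_simps)
    hence MK: "real (2 * K) \<le> real M" using B(3) by linarith
    have "M < (q + 1) * K" using K unfolding q_def
      by (metis Suc_eq_plus1 dividend_less_div_times mult.commute mult_Suc Suc_le_eq One_nat_def add.commute)
    hence "real M < (real q + 1) * real K" by (metis of_nat_less_iff of_nat_mult of_nat_add of_nat_1)
    hence "real M < real q * real K + real M / 2" using MK by (simp add: algebra_simps)
    hence "real M / 2 \<le> real q * real K" by linarith
    moreover have "1 / (2 * real l * u) / 2 \<le> real M / 2" by (rule divide_right_mono[OF B(3)]) simp
    ultimately have "1 / (2 * real l * u) / 2 \<le> real q * real K" by linarith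
    hence "1 / (2 * real l * u) / 2 / real K \<le> real q * real K / real K"
      by (rule divide_right_mono) simp
    hence q: "1 / (4 * real l * real K * u) \<le> real q" using K by (simp add: mult_ac)
    have "t\<^sup>2 / (24 * real l * real K * s\<^sup>2 * u) = (1 / (4 * real l * real K * u)) * a" by (simp add: a_def)
    also have "\<dots> \<le> real q * a" by (rule mult_right_mono[OF q a0])
    finally have "(1 + t\<^sup>2 / (24 * real l * real K * s\<^sup>2 * u)) ^ K \<le> (1 + real q * a) ^ K"
      using u0 by (intro power_mono) auto
    also have "\<dots> \<le> ((1 + a) ^ q) ^ K"
      using a0 Bernoulli_inequality[of a q] by (intro power_mono) auto
    also have "\<dots> = (1 + a) ^ (q * K)" by (simp add: power_mult)
    also have "\<dots> \<le> (1 + a) ^ M" using a0 by (intro power_increasing) (auto simp: q_def)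
    finally show "(1 + t\<^sup>2 / (24 * real l * real K * s\<^sup>2 * u)) ^ K \<le> (1 + a) ^ M" .
    have "1 + t\<^sup>2 / (24 * real l * real K * s\<^sup>2 * u) > 0" using u0 by (intro add_pos_nonneg) auto
    thus "0 < (1 + a) ^ M * (1 + t\<^sup>2 / (24 * real l * real K * s\<^sup>2 * u)) ^ K"
      using a0 by (intro mult_pos_pos zero_less_power) auto
  qed auto
  finally show ?thesis .
qed

text \<open>Since \<open>2 * a - c = 1\<close>, the angles \<open>a * t\<close> and \<open>c * t\<close> cannot both be close to 0 modulo \<open>2 * pi\<close>.\<close>

lemma one_minus_cos_le_combination:
  assumes "2 * a - c = (1::real)"
  shows "1 - cos t \<le> 5 * ((1 - cos (a * t)) + (1 - cos (c * t)))"
proof -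
  define x where "x = t / 2"
  have half: "1 - cos (b * t) = 2 * (sin (b * x))\<^sup>2" for b :: real
    using cos_double_sin[of "b * x"] by (simp add: x_def mult_ac)
  have "1 * x = 2 * (a * x) - c * x"
    unfolding assms[symmetric] by (simp add: algebra_simps)
  hence "sin (1 * x) = sin (2 * (a * x) - c * x)" by simp
  also have "\<dots> = 2 * sin (a * x) * cos (a * x) * cos (c * x) - cos (2 * (a * x)) * sin (c * x)"
    by (simp add: sin_diff sin_double)
  also have "\<bar>\<dots>\<bar> \<le> \<bar>2 * sin (a * x) * cos (a * x) * cos (c * x)\<bar> + \<bar>cos (2 * (a * x)) * sin (c * x)\<bar>"
    by (rule abs_triangle_ineq4)
  also have "\<dots> \<le> 2 * \<bar>sin (a * x)\<bar> * 1 * 1 + 1 * \<bar>sin (c * x)\<bar>"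
    unfolding abs_mult by (intro add_mono mult_mono) auto
  finally have "\<bar>sin (1 * x)\<bar>\<^sup>2 \<le> (2 * \<bar>sin (a * x)\<bar> + \<bar>sin (c * x)\<bar>)\<^sup>2"
    by (intro power_mono) auto
  also have "\<dots> \<le> 5 * ((sin (a * x))\<^sup>2 + (sin (c * x))\<^sup>2)"
    using zero_le_power2[of "\<bar>sin (a * x)\<bar> - 2 * \<bar>sin (c * x)\<bar>"]
    by (simp add: power2_eq_square algebra_simps)
  finally show ?thesis using half[of 1] half[of a] half[of c] by simp
qed

text \<open>The parts k l + 1 and 2 k l + 1 satisfy the relation 2 a - c = 1, so at least one of the
  two angles stays away from the multiples of 2 pi and each pair of factors contributes O(s^2).
  Taking \<open>K\<close> pairs gives the K-th power.\<close>

lemma char_fun_bound_far: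
  assumes l: "l \<ge> 2" and r: "r \<ge> 1" and s: "0 < s" "1 / s \<le> real J" "(4 * K * l + 1) * s \<le> 1"
    and t: "0 < t0" "t0 \<le> \<bar>t\<bar>" "\<bar>t\<bar> \<le> pi" and K: "K \<ge> 1"
  shows "(norm (char_fun l r J s t))\<^sup>2 \<le> (120 * (real K * real l)\<^sup>2 / (1 - cos t0) * s\<^sup>2) ^ K"
proof -
  \<comment> \<open>The factor 120 is 16 * 15 / 2: 16 from the bound 4 K l on the parts, 15 / 2 from
    the constants 2/3 and 1/5 of the two cosine estimates.\<close>
  define D where "D = 120 * (real K * real l)\<^sup>2 / (1 - cos t0)"
  have D: "D * (1 - cos t0) = 120 * (real K * real l)\<^sup>2" "1 - cos t0 > 0"
  proof -
    have "cos t0 < cos 0" using t by (intro cos_monotone_0_pi) auto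
    thus "1 - cos t0 > 0" by simp
    thus "D * (1 - cos t0) = 120 * (real K * real l)\<^sup>2" by (simp add: D_def)
  qed
  define a where "a = (\<lambda>k::nat. k * l + 1)"
  define c where "c = (\<lambda>k::nat. 2 * k * l + 1)"
  let ?q = "\<lambda>j. (norm (qfac (exp (-(s * real j))) (real j * t)))\<^sup>2"
  have ndvd: "\<not> l dvd m * l + 1" for m
  proof
    assume "l dvd m * l + 1"
    hence "l dvd 1" by (metis dvd_add_right_iff dvd_triv_right)
    thus False using l by simp
  qed
  have ac: "a k \<le> c k" "c k \<le> 4 * K * l" if k: "k \<in> {K..<2*K}" for k
  proof -
    show "a k \<le> c k" by (simp add: a_def c_def)
    have "(2 * k + 1) * l \<le> (4 * K) * l" using k by (intro mult_right_mono) auto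
    thus "c k \<le> 4 * K * l" using l by (simp add: c_def algebra_simps)
  qed
  have cs: "real (c k) * s \<le> 1" if k: "k \<in> {K..<2*K}" for k
  proof -
    have "real (c k) \<le> 4 * K * l + 1" using ac(2)[OF k] by linarith
    hence "real (c k) * s \<le> (4 * K * l + 1) * s" using s by (intro mult_right_mono) auto
    thus ?thesis using s(3) by linarith
  qed
  have cJ: "c k \<le> J" if k: "k \<in> {K..<2*K}" for k
  proof -
    have "real (c k) \<le> 1 / s" using cs[OF k] s(1) by (simp add: field_simps)
    thus ?thesis using s(2) by linarith
  qed
  have sub: "a ` {K..<2*K} \<union> c ` {K..<2*K} \<subseteq> parts l J"
  proof (intro Un_least image_subsetI)
    fix k assume k: "k \<in> {K..<2*K}"
    show "c k \<in> parts l J" using cJ[OF k] ndvd[of "2 * k"] by (simp add: parts_def c_def)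
    show "a k \<in> parts l J" using cJ[OF k] ac(1)[OF k] ndvd[of k] by (simp add: parts_def a_def)
  qed
  \<comment> \<open>The range of k is chosen for this: k < 2 K <= 2 k' separates the two
    families.\<close>
  have disj: "a ` {K..<2*K} \<inter> c ` {K..<2*K} = {}"
  proof -
    have "a k < c k'" if "k \<in> {K..<2*K}" "k' \<in> {K..<2*K}" for k k'
    proof -
      have "k < 2 * k'" using that by auto
      thus ?thesis using l by (simp add: a_def c_def)
    qed
    thus ?thesis by fastforce
  qed
  have inj: "inj_on a {K..<2*K}" "inj_on c {K..<2*K}"
    using l by (auto simp: inj_on_def a_def c_def)
  have "(norm (char_fun l r J s t))\<^sup>2 \<le> prod ?q (a ` {K..<2*K} \<union> c ` {K..<2*K})"
    by (rule norm_char_fun_le_prod[OF sub r s(1)])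
  also have "\<dots> = (\<Prod>k\<in>{K..<2*K}. ?q (a k)) * (\<Prod>k\<in>{K..<2*K}. ?q (c k))"
    using disj by (subst prod.union_disjoint) (simp_all add: prod.reindex inj o_def)
  also have "\<dots> = (\<Prod>k\<in>{K..<2*K}. ?q (a k) * ?q (c k))"
    by (rule prod.distrib[symmetric])
  also have "\<dots> \<le> (\<Prod>k\<in>{K..<2*K}. D * s\<^sup>2)"
  proof (intro prod_mono conjI)
    fix k assume k: "k \<in> {K..<2*K}"
    define A where "A = 2 / 3 * ((1 - cos (a k * t)) / (s * a k)\<^sup>2)"
    define C where "C = 2 / 3 * ((1 - cos (c k * t)) / (s * c k)\<^sup>2)"
    define N where "N = (s * (4 * K * l))\<^sup>2"
    have pos: "a k > 0" "c k > 0" by (auto simp: a_def c_def)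
    have sKl: "s * (4 * real K * real l) > 0" using s K l by simp
    hence "(s * (4 * real K * real l))\<^sup>2 > 0" by (rule zero_less_power)
    hence N0: "N > 0" by (simp only: N_def of_nat_mult of_nat_numeral)
    have AC0: "A \<ge> 0" "C \<ge> 0" by (auto simp: A_def C_def)
    have le: "real (a k) \<le> real (c k)" "real (c k) \<le> real (4 * K * l)"
      using ac[OF k] by (simp_all only: of_nat_le_iff)
    have sk: "0 < s * a k" "s * a k \<le> 1" "0 < s * c k" "s * c k \<le> 1"
    proof -
      show "0 < s * a k" "0 < s * c k" using pos s by simp_all
      show "s * c k \<le> 1" using cs[OF k] by (simp add: mult.commute)
      thus "s * a k \<le> 1" using mult_left_mono[OF le(1), of s] s by linarith
    qed
    have qle: "?q (a k) * ?q (c k) \<le> 1 / (1 + A) * (1 / (1 + C))"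
      using norm_qfac_le[OF sk(1,2), of "a k * t"] norm_qfac_le[OF sk(3,4), of "c k * t"] AC0
      unfolding A_def C_def by (intro mult_mono) auto
    have "(1 - cos (a k * t)) / (s * a k)\<^sup>2 \<ge> (1 - cos (a k * t)) / N"
      unfolding N_def using s pos le sKl
      by (intro divide_left_mono power_mono mult_left_mono mult_pos_pos zero_less_power) auto
    moreover have "(1 - cos (c k * t)) / (s * c k)\<^sup>2 \<ge> (1 - cos (c k * t)) / N"
      unfolding N_def using s pos le sKl
      by (intro divide_left_mono power_mono mult_left_mono mult_pos_pos zero_less_power) auto
    ultimately have "A + C \<ge> 2 / 3 * (((1 - cos (a k * t)) + (1 - cos (c k * t))) / N)"
      unfolding A_def C_def add_divide_distrib[of "1 - cos (a k * t)"] distrib_left[of "2 / 3"]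
      by (intro add_mono mult_left_mono) auto
    moreover have "(1 - cos (a k * t)) + (1 - cos (c k * t)) \<ge> (1 - cos t) / 5"
      using one_minus_cos_le_combination[of "real (a k)" "real (c k)" t] by (simp add: a_def c_def)
    moreover have "cos t \<le> cos t0"
      using t cos_monotone_0_pi_le[of t0 "\<bar>t\<bar>"] by simp
    ultimately have "A + C \<ge> 2 / 3 * (((1 - cos t0) / 5) / N)"
      using N0 by (smt (verit) divide_right_mono mult_left_mono divide_nonneg_nonneg)
    also have "2 / 3 * (((1 - cos t0) / 5) / N) = 1 / (D * s\<^sup>2)"
    proof -
      have "N = 16 * s\<^sup>2 * (real K * real l)\<^sup>2" by (simp add: N_def power_mult_distrib)
      hence N: "N = s\<^sup>2 * (D * (1 - cos t0)) * 2 / 15" using D by simp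
      have "2 / 3 * (e / 5 / (S * (D * e) * 2 / 15)) = 1 / (D * S)" if "e > 0" for e S :: real
        using that by simp
      from this[OF D(2)] show ?thesis unfolding N .
    qed
    finally have AC: "1 / (D * s\<^sup>2) \<le> A + C" .
    have Ds: "0 < D * s\<^sup>2" using D s K l by (simp add: D_def)
    have "1 / (D * s\<^sup>2) \<le> (1 + A) * (1 + C)"
    proof -
      have "(1 + A) * (1 + C) = 1 + A * C + (A + C)" by (simp add: algebra_simps)
      thus ?thesis using AC mult_nonneg_nonneg[OF AC0] by linarith
    qed
    hence "1 / ((1 + A) * (1 + C)) \<le> 1 / (1 / (D * s\<^sup>2))"
      using Ds AC0 by (intro divide_left_mono) (auto intro!: mult_pos_pos)
    thus "?q (a k) * ?q (c k) \<le> D * s\<^sup>2" using qle by simp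
  qed auto
  finally show ?thesis by (simp add: D_def)
qed

text \<open>Three ranges of t are combined: |t| <= s, where the near bound is used with u = s; s <
  |t| <= u0, where it is used with u = |t|; and the rest, where the far bound applies. In the last
  two ranges 1 + t^2 / s^3 is O(s^(-3)), so a sufficient power of s is enough.\<close>

lemma char_fun_dominated:
  assumes l: "l \<ge> 2" and P: "P \<ge> 1"
  obtains C s0 where "C > 0" "s0 > 0"
    "\<And>r J s t. \<lbrakk>r \<ge> 1; 0 < s; s < s0; 1 / s \<le> real J; \<bar>t\<bar> \<le> pi\<rbrakk> \<Longrightarrow>
       (norm (char_fun l r J s t))\<^sup>2 \<le> C / (1 + t\<^sup>2 / s ^ 3) ^ P"
proof -
  \<comment> \<open>In the middle range \<open>K\<close> factors of order s must make up
    \<open>P\<close> factors of order s^3.\<close>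
  define K where "K = 3 * P"
  have K: "K \<ge> 1" using P by (simp add: K_def)
  define u0 where "u0 = 1 / (4 * real l * real K)"
  define s0 where "s0 = 1 / (4 * real K * real l + 1)"
  define c where "c = 1 / (24 * real l * real K)"
  define D where "D = 120 * (real K * real l)\<^sup>2 / (1 - cos u0)"
  \<comment> \<open>One summand for each range, in the order |t| <= s, middle range, far range; 17
    bounds s^3 + t^2 via pi < 4.\<close>
  define C where "C = (1 / c) ^ P + (2 / c ^ 3) ^ P + D ^ K * 17 ^ P"
  have lK: "1 * 1 \<le> real l * real K" using l K by (intro mult_mono) auto
  have u0: "0 < u0" "u0 \<le> 1" using lK l K by (auto simp: u0_def field_simps)
  have s0: "0 < s0" "s0 < u0" "s0 \<le> 1"
    using lK l K by (auto simp: s0_def u0_def field_simps add_pos_nonneg)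
  have c: "0 < c" "c \<le> 1" using lK l K by (auto simp: c_def field_simps)
  have "cos u0 < cos 0" using u0 pi_gt3 by (intro cos_monotone_0_pi) auto
  hence D: "D > 0" using l K by (simp add: D_def)
  have bound: "(norm (char_fun l r J s t))\<^sup>2 \<le> C / (1 + t\<^sup>2 / s ^ 3) ^ P"
    if r: "r \<ge> 1" and s: "0 < s" "s < s0" "1 / s \<le> real J" and t: "\<bar>t\<bar> \<le> pi" for r J s t
  proof -
    define w where "w = t\<^sup>2 / s ^ 3"
    have w: "w \<ge> 0" using s by (simp add: w_def)
    have s1: "s \<le> 1" using s s0 by linarith
    have s3: "s ^ 3 \<le> 1" "s ^ 3 > 0" using s s1 by (auto intro: power_le_one)
    have "\<exists>C'. C' \<le> C \<and> (norm (char_fun l r J s t))\<^sup>2 \<le> C' / (1 + w) ^ P"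
    proof (cases "\<bar>t\<bar> \<le> u0")
      case False
      have "(norm (char_fun l r J s t))\<^sup>2 \<le> (D * s\<^sup>2) ^ K"
        unfolding D_def using s s0 u0 False t lK
        by (intro char_fun_bound_far[OF l r s(1,3) _ u0(1) _ t K]) (auto simp: s0_def field_simps add_pos_nonneg)
      also have "\<dots> = D ^ K * (s ^ 6) ^ P" by (simp add: K_def power_mult_distrib flip: power_mult)
      also have "\<dots> \<le> D ^ K * (17 / (1 + w)) ^ P"
      proof (intro mult_left_mono power_mono)
        have "\<bar>t\<bar>\<^sup>2 \<le> 4\<^sup>2" using t pi_less_4 by (intro power_mono) auto
        hence "s ^ 3 + t\<^sup>2 \<le> 17" using s3 by simp
        hence "(s ^ 3 + t\<^sup>2) / s ^ 3 \<le> 17 / s ^ 3" using s3 by (intro divide_right_mono) auto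
        hence "1 + w \<le> 17 / s ^ 3" using s3 by (simp add: w_def add_divide_distrib)
        hence "s ^ 3 \<le> 17 / (1 + w)" using s3 w by (simp add: field_simps)
        moreover have "s ^ 6 \<le> s ^ 3" using s s1 by (intro power_decreasing) auto
        ultimately show "s ^ 6 \<le> 17 / (1 + w)" by linarith
      qed (use s D in auto)
      finally have "(norm (char_fun l r J s t))\<^sup>2 \<le> (D ^ K * 17 ^ P) / (1 + w) ^ P"
        by (simp add: power_divide)
      thus ?thesis using c D by (intro exI[of _ "D ^ K * 17 ^ P"]) (auto simp: C_def)
    next
      case True
      show ?thesis
      proof (cases "\<bar>t\<bar> \<le> s")
        case True
        have "(norm (char_fun l r J s t))\<^sup>2 \<le> 1 / (1 + t\<^sup>2 / (24 * real l * real K * s\<^sup>2 * s)) ^ K"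
          using s s0 True by (intro char_fun_bound_near[OF l r K s(1,3)]) (auto simp: u0_def)
        also have "t\<^sup>2 / (24 * real l * real K * s\<^sup>2 * s) = c * w"
          by (simp add: c_def w_def power3_eq_cube power2_eq_square mult_ac)
        also have "1 / (1 + c * w) ^ K \<le> 1 / (c * (1 + w)) ^ P"
        proof (rule divide_left_mono)
          have "(c * (1 + w)) ^ P \<le> (1 + c * w) ^ P" using c w by (intro power_mono) (auto simp: algebra_simps)
          also have "\<dots> \<le> (1 + c * w) ^ K" using c w by (intro power_increasing) (auto simp: K_def)
          finally show "(c * (1 + w)) ^ P \<le> (1 + c * w) ^ K" .
        qed (use c w in \<open>auto intro!: mult_pos_pos zero_less_power add_pos_nonneg\<close>)
        also have "\<dots> = (1 / c) ^ P / (1 + w) ^ P" by (simp add: power_mult_distrib power_divide)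
        finally show ?thesis using c D by (intro exI[of _ "(1 / c) ^ P"]) (auto simp: C_def)
      next
        case False
        hence ts: "s < \<bar>t\<bar>" by simp
        have "(norm (char_fun l r J s t))\<^sup>2 \<le> 1 / (1 + t\<^sup>2 / (24 * real l * real K * s\<^sup>2 * \<bar>t\<bar>)) ^ K"
          using True ts by (intro char_fun_bound_near[OF l r K s(1,3)]) (auto simp: u0_def)
        also have "\<dots> \<le> 1 / (c / s) ^ K"
        proof (intro divide_left_mono power_mono)
          have "c / s = c * s / s\<^sup>2" using s by (simp add: power2_eq_square)
          also have "\<dots> \<le> c * \<bar>t\<bar> / s\<^sup>2" using ts c by (intro divide_right_mono mult_left_mono) auto
          also have "\<dots> = t\<^sup>2 / (24 * real l * real K * s\<^sup>2 * \<bar>t\<bar>)"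
            using ts s by (simp add: c_def power2_eq_square abs_if)
          finally show "c / s \<le> 1 + t\<^sup>2 / (24 * real l * real K * s\<^sup>2 * \<bar>t\<bar>)" by simp
        qed (use c s ts in \<open>auto intro!: mult_pos_pos zero_less_power add_pos_nonneg\<close>)
        also have "\<dots> = (s ^ 3 / c ^ 3) ^ P"
          by (simp add: K_def power_mult power_divide)
        also have "\<dots> \<le> (2 / c ^ 3 / (1 + w)) ^ P"
        proof (intro power_mono)
          have "\<bar>t\<bar>\<^sup>2 \<le> 1\<^sup>2" using True u0 by (intro power_mono) auto
          hence "s ^ 3 + t\<^sup>2 \<le> 2" using s3 by simp
          hence "(s ^ 3 + t\<^sup>2) / s ^ 3 \<le> 2 / s ^ 3" using s3 by (intro divide_right_mono) auto
        hence "1 + w \<le> 2 / s ^ 3" using s3 by (simp add: w_def add_divide_distrib)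
          hence "s ^ 3 \<le> 2 / (1 + w)" using s3 w by (simp add: field_simps)
          hence "s ^ 3 / c ^ 3 \<le> 2 / (1 + w) / c ^ 3" using c by (intro divide_right_mono) auto
          thus "s ^ 3 / c ^ 3 \<le> 2 / c ^ 3 / (1 + w)" by (simp add: mult.commute)
        qed (use s c in auto)
        also have "\<dots> = (2 / c ^ 3) ^ P / (1 + w) ^ P" by (simp only: power_divide)
        finally show ?thesis using c D by (intro exI[of _ "(2 / c ^ 3) ^ P"]) (auto simp: C_def)
      qed
    qed
    then obtain C' where "C' \<le> C" "(norm (char_fun l r J s t))\<^sup>2 \<le> C' / (1 + w) ^ P" by blast
    moreover have "C' / (1 + w) ^ P \<le> C / (1 + w) ^ P"
      using \<open>C' \<le> C\<close> w by (intro divide_right_mono) auto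
    ultimately show ?thesis unfolding w_def by linarith
  qed
  have "C > 0" unfolding C_def using c D by (intro add_pos_pos) auto
  show ?thesis by (rule that[OF \<open>C > 0\<close> s0(1) bound])
qed

section \<open>Cumulants and the saddle point\<close>

text \<open>Multiplied by \<open>r\<close>, the cases m = 1 and m = 2 are the mean and the variance
  of the sum of geometric variables. For m = 3 the true third cumulant has an extra factor 1 + x in
  each term, so this is the cumulant up to a factor 2, which suffices for error bounds.\<close>

definition cum :: "nat \<Rightarrow> nat \<Rightarrow> nat \<Rightarrow> real \<Rightarrow> real" where
  "cum l J m s = (\<Sum>j\<in>parts l J. real j ^ m * exp (-(s * j)) / (1 - exp (-(s * j))) ^ m)"

text \<open>From 1 - exp (-y) >= y / (1 + y), the power (1 + y)^m is absorbed by half of the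
  exponential; the other half is kept to make the sum over the parts converge.\<close>

lemma exp_over_power_bound:
  fixes y :: real
  assumes y: "y > 0" and m: "m \<ge> 1"
  shows "exp (-y) / (1 - exp (-y)) ^ m \<le> (2 * real m) ^ m * exp (- y / 2) / y ^ m"
proof -
  have "1 / exp y \<le> 1 / (1 + y)"
    using exp_ge_add_one_self[of y] y by (intro divide_left_mono) auto
  hence "y / (1 + y) \<le> 1 - exp (-y)" using y by (simp add: exp_minus field_simps)
  hence "(y / (1 + y)) ^ m \<le> (1 - exp (-y)) ^ m" using y by (intro power_mono) auto
  hence "exp (-y) / (1 - exp (-y)) ^ m \<le> exp (-y) / (y / (1 + y)) ^ m"
    using y by (intro divide_left_mono) (auto intro!: mult_pos_pos zero_less_power divide_pos_pos)
  also have "\<dots> = exp (-y) * (1 + y) ^ m / y ^ m" by (simp add: power_divide)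
  also have "\<dots> \<le> exp (-y) * ((2 * real m) ^ m * exp (y / 2)) / y ^ m"
  proof (intro divide_right_mono mult_left_mono)
    have "1 + y \<le> 2 * real m * (1 + y / (2 * real m))" using m y by (simp add: field_simps)
    also have "\<dots> \<le> 2 * real m * exp (y / (2 * real m))" by (intro mult_left_mono) auto
    finally have "(1 + y) ^ m \<le> (2 * real m * exp (y / (2 * real m))) ^ m"
      using y by (intro power_mono) auto
    also have "\<dots> = (2 * real m) ^ m * exp (real m * (y / (2 * real m)))"
      by (simp only: power_mult_distrib exp_of_nat_mult)
    also have "real m * (y / (2 * real m)) = y / 2" using m by simp
    finally show "(1 + y) ^ m \<le> (2 * real m) ^ m * exp (y / 2)" .
  qed (use y in auto)
  also have "exp (-y) * ((2 * real m) ^ m * exp (y / 2)) = (2 * real m) ^ m * exp (- y / 2)"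
    by (simp add: mult_exp_exp)
  finally show ?thesis .
qed

lemma sum_exp_le:
  fixes s :: real
  assumes "s > 0"
  shows "(\<Sum>j\<in>{1..J}. exp (-(s * real j) / 2)) \<le> 2 / s"
proof -
  define q where "q = exp (- s / 2)"
  have q: "0 < q" "q < 1" using assms by (auto simp: q_def)
  have "q * (1 + s / 2) \<le> q * exp (s / 2)" using q by (intro mult_left_mono) auto
  also have "\<dots> = 1" by (simp add: q_def mult_exp_exp)
  finally have qs: "q / (1 - q) \<le> 2 / s" using q assms by (simp add: field_simps)
  have "(\<Sum>j\<in>{1..J}. exp (-(s * real j) / 2)) = (\<Sum>j\<in>{1..J}. q ^ j)"
    by (simp add: q_def exp_of_nat_mult[symmetric] mult_ac)
  also have "\<dots> = q * (\<Sum>j<J. q ^ j)"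
    by (simp add: sum_distrib_left sum.atLeast_Suc_atMost_Suc_shift sum.atLeast1_atMost_eq)
  also have "\<dots> \<le> q * (1 / (1 - q))"
    using q by (intro mult_left_mono) (auto simp: sum_gp_strict intro!: divide_right_mono)
  finally show ?thesis using qs by simp
qed

text \<open>The power j^m cancels against (s j)^m, and the remaining geometric sum is of order 1 /
  s. The bound is uniform in \<open>l\<close> and \<open>J\<close>.\<close>

lemma cum_le:
  assumes s: "s > 0" and m: "m \<ge> 1"
  shows "cum l J m s \<le> 2 * (2 * real m) ^ m / s ^ Suc m"
proof -
  have "cum l J m s \<le> (\<Sum>j\<in>parts l J. (2 * real m) ^ m / s ^ m * exp (-(s * real j) / 2))"
    unfolding cum_def
  proof (rule sum_mono)
    fix j assume "j \<in> parts l J"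
    hence j: "real j > 0" using parts_pos by simp
    have "real j ^ m * (exp (-(s * j)) / (1 - exp (-(s * j))) ^ m)
       \<le> real j ^ m * ((2 * real m) ^ m * exp (- (s * j) / 2) / (s * j) ^ m)"
      using j s by (intro mult_left_mono exp_over_power_bound m) auto
    also have "\<dots> = (2 * real m) ^ m / s ^ m * exp (-(s * real j) / 2)"
      using j by (simp add: power_mult_distrib)
    finally show "real j ^ m * exp (-(s * j)) / (1 - exp (-(s * j))) ^ m
       \<le> (2 * real m) ^ m / s ^ m * exp (-(s * real j) / 2)" by simp
  qed
  also have "\<dots> \<le> (\<Sum>j\<in>{1..J}. (2 * real m) ^ m / s ^ m * exp (-(s * real j) / 2))"
    using s by (intro sum_mono2) (auto simp: parts_def)
  also have "\<dots> \<le> (2 * real m) ^ m / s ^ m * (2 / s)"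
    unfolding sum_distrib_left[symmetric] using s by (intro mult_left_mono sum_exp_le) auto
  finally show ?thesis by (simp add: mult_ac)
qed

lemma cum_nonneg: "s > 0 \<Longrightarrow> cum l J m s \<ge> 0"
  unfolding cum_def by (intro sum_nonneg divide_nonneg_nonneg mult_nonneg_nonneg) auto

text \<open>The part 1 alone gives this crude bound, which is enough to locate the lower end of the
  interval for the saddle point.\<close>

lemma cum_1_ge:
  assumes "l \<ge> 2" "J \<ge> 1" "s > 0"
  shows "cum l J 1 s \<ge> 1 / s - 1"
proof -
  define x where "x = exp (-s)"
  have x: "0 < x" "x < 1" using assms by (auto simp: x_def)
  have "1 - s \<le> x" unfolding x_def using exp_ge_add_one_self[of "-s"] by simp
  hence "1 / s \<le> 1 / (1 - x)" using x assms by (intro divide_left_mono) auto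
  also have "\<dots> = x / (1 - x) + 1" using x by (simp add: field_simps)
  finally have "1 / s - 1 \<le> real 1 ^ 1 * exp (-(s * real 1)) / (1 - exp (-(s * real 1))) ^ 1"
    by (simp add: x_def)
  also have "\<dots> \<le> cum l J 1 s"
    unfolding cum_def
    by (rule member_le_sum) (use assms in \<open>auto simp: parts_def intro!: divide_nonneg_nonneg\<close>)
  finally show ?thesis .
qed

text \<open>At least 1 / (2 l s) parts of the progression lie below 1 / s, and each contributes at
  least 1 / (3 s^2).\<close>

lemma cum_2_ge:
  assumes l: "l \<ge> 2" and s: "0 < s" "s \<le> 1 / 2" "1 / s \<le> real J"
  shows "cum l J 2 s \<ge> 1 / (6 * real l * s ^ 3)"
proof -
  define M where "M = nat \<lceil>1 / (2 * real l * s)\<rceil>"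
  note B = progression_subset_parts[OF l s, folded M_def]
  let ?f = "\<lambda>j. real j ^ 2 * exp (-(s * j)) / (1 - exp (-(s * j))) ^ 2"
  have "1 / (6 * real l * s ^ 3) = 1 / (2 * real l * s) * (1 / (3 * s\<^sup>2))"
    by (simp add: power2_eq_square power3_eq_cube)
  also have "\<dots> \<le> real M * (1 / (3 * s\<^sup>2))"
    by (rule mult_right_mono[OF B(3)]) simp
  also have "\<dots> = (\<Sum>j\<in>(\<lambda>i. i * l + 1) ` {..<M}. 1 / (3 * s\<^sup>2))"
    using card_image[OF B(4)] by simp
  also have "\<dots> \<le> (\<Sum>j\<in>(\<lambda>i. i * l + 1) ` {..<M}. ?f j)"
  proof (rule sum_mono)
    fix j assume "j \<in> (\<lambda>i. i * l + 1) ` {..<M}"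
    then obtain i where i: "i < M" "j = i * l + 1" by auto
    have y: "s * j \<le> 1" "0 < s * j" using B(2)[OF i(1)] i(2) s by (simp_all add: mult.commute add_pos_nonneg)
    define x where "x = exp (-(s * j))"
    have "exp (s * j) \<le> exp 1" using y by simp
    also have "\<dots> < 3" using e_less_272 by simp
    finally have x3: "1 / 3 \<le> x" by (simp add: x_def exp_minus field_simps)
    have x1: "x < 1" using y by (simp add: x_def)
    have "1 - x \<le> s * j" unfolding x_def using exp_ge_add_one_self[of "-(s * j)"] by simp
    hence "(1 - x)\<^sup>2 \<le> (s * j)\<^sup>2" using x1 by (intro power_mono) auto
    hence "real j ^ 2 * (1 / 3) / (s * j)\<^sup>2 \<le> real j ^ 2 * x / (1 - x)\<^sup>2"
      using x1 x3 y by (intro frac_le mult_left_mono mult_nonneg_nonneg) auto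
    moreover have "j \<noteq> 0" using i by simp
    ultimately show "1 / (3 * s\<^sup>2) \<le> ?f j" by (simp add: x_def power_mult_distrib)
  qed
  also have "\<dots> \<le> cum l J 2 s"
    unfolding cum_def using B(1) s
    by (intro sum_mono2) (auto intro!: divide_nonneg_nonneg)
  finally show ?thesis .
qed

text \<open>Intermediate value theorem, with endpoints at which \<open>cum_1_ge\<close> and
  \<open>cum_le\<close> give exactly n. The upper endpoint forces s to 0, and the lower one gives 1
  / s <= n + 1, so that the cutoff n + d reaches 1 / s.\<close>

lemma ex_saddle_point:
  assumes l: "l \<ge> 2" and r: "r \<ge> 1" and n: "n \<ge> 1" and J: "J \<ge> 1"
  shows "\<exists>s. 1 / (real n + 1) \<le> s \<and> s \<le> 2 * sqrt (real r / real n) \<and> real r * cum l J 1 s = real n"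
proof (rule IVT2)
  let ?b = "2 * sqrt (real r / real n)"
  have b: "?b > 0" using r n by simp
  have "real r * cum l J 1 ?b \<le> real r * (2 * (2 * real 1) ^ 1 / ?b ^ Suc 1)"
    by (intro mult_left_mono cum_le b) auto
  also have "\<dots> = real n" using r n by (simp add: power_mult_distrib)
  finally show "real r * cum l J 1 ?b \<le> real n" .
  have "real n = 1 * (1 / (1 / (real n + 1)) - 1)" by simp
  also have "\<dots> \<le> real r * cum l J 1 (1 / (real n + 1))"
    using r by (intro mult_mono cum_1_ge l J) auto
  finally show "real n \<le> real r * cum l J 1 (1 / (real n + 1))" .
  have "1 / (real n + 1) \<le> sqrt (1 / real n)"
  proof (rule real_le_rsqrt)
    have "real n * 1 \<le> (real n + 1) * (real n + 1)" by (intro mult_mono) auto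
    hence "1 / ((real n + 1) * (real n + 1)) \<le> 1 / real n" using n by (intro divide_left_mono) auto
    thus "(1 / (real n + 1))\<^sup>2 \<le> 1 / real n" by (simp add: power2_eq_square)
  qed
  also have "\<dots> \<le> sqrt (real r / real n)" using r by (intro real_sqrt_le_mono divide_right_mono) auto
  also have "\<dots> \<le> ?b" by simp
  finally show "1 / (real n + 1) \<le> ?b" .
  show "\<forall>x. 1 / (real n + 1) \<le> x \<and> x \<le> ?b \<longrightarrow> isCont (\<lambda>s. real r * cum l J 1 s) x"
  proof (intro allI impI)
    fix x assume "1 / (real n + 1) \<le> x \<and> x \<le> ?b"
    moreover have "1 / (real n + 1) > 0" by simp
    ultimately have "x > 0" by linarith
    thus "isCont (\<lambda>s. real r * cum l J 1 s) x"
      unfolding cum_def by (intro continuous_intros) (auto dest: parts_pos)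
  qed
qed

section \<open>Second order expansion of the logarithm of the characteristic function\<close>

text \<open>Taylor's theorem for -Ln (1 - x exp z) on the segment from 0 to \<open>\<i> * a\<close>.
  There exp z has modulus 1, so the third derivative is at most 2 x / (1 - x)^3.\<close>

lemma qfac_expansion:
  assumes x: "0 < x" "x < 1"
  obtains R where "qfac x a = exp (\<i> * of_real (x / (1 - x) * a) - of_real (x / (1 - x)\<^sup>2 * a\<^sup>2 / 2) + R)"
    "norm R \<le> x / (1 - x) ^ 3 * \<bar>a\<bar> ^ 3"
proof -
  \<comment> \<open>The function and its first three derivatives; every later index repeats the
    third derivative.\<close>
  define f :: "nat \<Rightarrow> complex \<Rightarrow> complex" where
    "f = (\<lambda>i z. if i = 0 then - Ln (1 - of_real x * exp z)
       else if i = 1 then of_real x * exp z / (1 - of_real x * exp z)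
       else if i = 2 then of_real x * exp z / (1 - of_real x * exp z)\<^sup>2
       else of_real x * exp z * (1 + of_real x * exp z) / (1 - of_real x * exp z) ^ 3)"
  define S where "S = closed_segment 0 (\<i> * of_real a)"
  have nexp: "norm (exp z) = 1" if "z \<in> S" for z
    using that by (auto simp: S_def closed_segment_def norm_exp_eq_Re)
  \<comment> \<open>A positive real part keeps the argument of \<open>Ln\<close> off its branch cut,
    for every real \<open>a\<close>.\<close>
  have Re: "Re (1 - of_real x * exp z) > 0" if "z \<in> S" for z
  proof -
    have "Re (of_real x * exp z) \<le> norm (of_real x * exp z)" by (rule complex_Re_le_cmod)
    also have "\<dots> = x" using nexp[OF that] x by (simp add: norm_mult)
    finally show ?thesis unfolding minus_complex.sel one_complex.sel using x by linarith
  qed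
  have nz: "1 - of_real x * exp z \<noteq> 0" "1 - of_real x * exp z \<notin> \<real>\<^sub>\<le>\<^sub>0" if "z \<in> S" for z
  proof -
    show "1 - of_real x * exp z \<notin> \<real>\<^sub>\<le>\<^sub>0" using Re[OF that] unfolding complex_nonpos_Reals_iff by linarith
    show "1 - of_real x * exp z \<noteq> 0" using Re[OF that] by (metis less_irrefl zero_complex.sel(1))
  qed
  have low: "norm (1 - of_real x * exp z) \<ge> 1 - x" if "z \<in> S" for z
    using norm_triangle_ineq2[of 1 "of_real x * exp z"] nexp[OF that] x by (simp add: norm_mult)
  have "norm (f 0 (\<i> * of_real a) - (\<Sum>i\<le>2. f i 0 * (\<i> * of_real a - 0) ^ i / fact i))
      \<le> (2 * x / (1 - x) ^ 3) * norm (\<i> * of_real a - 0) ^ Suc 2 / fact 2"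
  proof (rule complex_Taylor[of S])
    fix i z assume z: "z \<in> S" and i: "i \<le> (2::nat)"
    consider "i = 0" | "i = 1" | "i = 2" using i by linarith
    thus "(f i has_field_derivative f (Suc i) z) (at z within S)"
    proof cases
      case 1
      show ?thesis unfolding f_def 1 using nz[OF z]
        by (auto intro!: derivative_eq_intros simp: divide_simps)
    next
      case 2
      show ?thesis unfolding f_def 2 using nz[OF z]
        by (auto intro!: derivative_eq_intros simp: field_simps power2_eq_square)
    next
      case 3
      show ?thesis unfolding f_def 3 using nz[OF z]
        by (auto intro!: derivative_eq_intros simp: divide_simps power2_eq_square power3_eq_cube)
           (auto simp: algebra_simps)
    qed
  next
    fix z assume z: "z \<in> S"
    have "norm (1 + of_real x * exp z) \<le> 2"
      using norm_triangle_ineq[of 1 "of_real x * exp z"] nexp[OF z] x by (simp add: norm_mult)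
    hence "norm (f (Suc 2) z) \<le> x * 2 / (1 - x) ^ 3"
      unfolding f_def using nexp[OF z] x low[OF z]
      by (auto simp: norm_mult norm_divide norm_power numeral_3_eq_3 intro!: frac_le mult_left_mono power_mono mult_mono)
    thus "norm (f (Suc 2) z) \<le> 2 * x / (1 - x) ^ 3" by (simp add: mult.commute)
  qed (auto simp: S_def)
  note taylor = this
  define R where "R = f 0 (\<i> * of_real a) - (\<Sum>i\<le>2. f i 0 * (\<i> * of_real a - 0) ^ i / fact i)"
  have "norm (\<i> * of_real a - 0) ^ Suc 2 = \<bar>a\<bar> ^ 3" by (simp add: norm_mult)
  hence "norm R \<le> x / (1 - x) ^ 3 * \<bar>a\<bar> ^ 3"
    using taylor[folded R_def] by (simp only:) simp
  moreover have "qfac x a = exp (\<i> * of_real (x / (1 - x) * a) - of_real (x / (1 - x)\<^sup>2 * a\<^sup>2 / 2) + R)"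
  proof -
    have mem: "0 \<in> S" "\<i> * of_real a \<in> S" by (auto simp: S_def)
    have "f 0 (\<i> * of_real a) = f 0 0 + (\<i> * of_real (x / (1 - x) * a) - of_real (x / (1 - x)\<^sup>2 * a\<^sup>2 / 2) + R)"
      by (simp add: R_def f_def numeral_2_eq_2 power2_eq_square mult_ac)
    hence "exp (\<i> * of_real (x / (1 - x) * a) - of_real (x / (1 - x)\<^sup>2 * a\<^sup>2 / 2) + R) = exp (f 0 (\<i> * of_real a) - f 0 0)"
      by simp
    also have "\<dots> = exp (Ln (1 - of_real x * exp 0)) / exp (Ln (1 - of_real x * exp (\<i> * of_real a)))"
      by (simp add: f_def exp_diff exp_minus field_simps)
    also have "\<dots> = (1 - of_real x * exp 0) / (1 - of_real x * exp (\<i> * of_real a))"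
      using exp_Ln[OF nz(1)[OF mem(1)]] exp_Ln[OF nz(1)[OF mem(2)]] by (simp only:)
    also have "\<dots> = qfac x a" by (simp add: qfac_def cis_conv_exp)
    finally show ?thesis ..
  qed
  ultimately show ?thesis using that by blast
qed

lemma char_fun_expansion:
  assumes s: "s > 0"
  obtains R where
    "char_fun l r J s t = exp (\<i> * of_real (r * cum l J 1 s * t) - of_real (r * cum l J 2 s * t\<^sup>2 / 2) + R)"
    "norm R \<le> r * cum l J 3 s * \<bar>t\<bar> ^ 3"
proof -
  define x where "x = (\<lambda>j::nat. exp (-(s * real j)))"
  have x: "0 < x j" "x j < 1" if "j \<in> parts l J" for j
    using s parts_pos[OF that] by (auto simp: x_def)
  have "\<exists>R. qfac (x j) (j * t) = exp (\<i> * of_real (x j / (1 - x j) * (j * t)) - of_real (x j / (1 - x j)\<^sup>2 * (j * t)\<^sup>2 / 2) + R) \<and>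
      norm R \<le> x j / (1 - x j) ^ 3 * \<bar>j * t\<bar> ^ 3" if "j \<in> parts l J" for j
    using qfac_expansion[OF x[OF that], of "j * t"] by metis
  then obtain R where R: "\<And>j. j \<in> parts l J \<Longrightarrow>
       qfac (x j) (j * t) = exp (\<i> * of_real (x j / (1 - x j) * (j * t)) - of_real (x j / (1 - x j)\<^sup>2 * (j * t)\<^sup>2 / 2) + R j)"
      "\<And>j. j \<in> parts l J \<Longrightarrow> norm (R j) \<le> x j / (1 - x j) ^ 3 * \<bar>j * t\<bar> ^ 3"
    by metis
  show ?thesis
  proof (rule that[of "of_nat r * (\<Sum>j\<in>parts l J. R j)"])
    have "char_fun l r J s t = (\<Prod>j\<in>parts l J. qfac (x j) (j * t)) ^ r"
      by (simp add: char_fun_def x_def prod_power_distrib)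
    also have "(\<Prod>j\<in>parts l J. qfac (x j) (j * t)) = exp (\<Sum>j\<in>parts l J.
        \<i> * of_real (x j / (1 - x j) * (j * t)) - of_real (x j / (1 - x j)\<^sup>2 * (j * t)\<^sup>2 / 2) + R j)"
      by (simp add: R(1) exp_sum)
    also have "(\<Sum>j\<in>parts l J. \<i> * of_real (x j / (1 - x j) * (j * t)) - of_real (x j / (1 - x j)\<^sup>2 * (j * t)\<^sup>2 / 2) + R j)
      = \<i> * of_real (cum l J 1 s * t) - of_real (cum l J 2 s * t\<^sup>2 / 2) + (\<Sum>j\<in>parts l J. R j)"
    proof -
      have "cum l J 1 s * t = (\<Sum>j\<in>parts l J. x j / (1 - x j) * (j * t))"
        unfolding cum_def sum_distrib_right by (intro sum.cong) (auto simp: x_def)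
      moreover have "cum l J 2 s * t\<^sup>2 / 2 = (\<Sum>j\<in>parts l J. x j / (1 - x j)\<^sup>2 * (j * t)\<^sup>2 / 2)"
        unfolding cum_def sum_distrib_right sum_divide_distrib
        by (intro sum.cong) (auto simp: x_def power_mult_distrib)
      ultimately show ?thesis
        by (simp only: of_real_sum sum_distrib_left sum.distrib sum_subtractf)
    qed
    also have "exp (\<dots>) ^ r = exp (of_nat r * (\<i> * of_real (cum l J 1 s * t) - of_real (cum l J 2 s * t\<^sup>2 / 2) + (\<Sum>j\<in>parts l J. R j)))"
      by (rule exp_of_nat_mult[symmetric])
    finally show "char_fun l r J s t = exp (\<i> * of_real (r * cum l J 1 s * t) - of_real (r * cum l J 2 s * t\<^sup>2 / 2) +
        of_nat r * (\<Sum>j\<in>parts l J. R j))"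
      by (simp add: algebra_simps)
  next
    have "norm (\<Sum>j\<in>parts l J. R j) \<le> (\<Sum>j\<in>parts l J. x j / (1 - x j) ^ 3 * \<bar>j * t\<bar> ^ 3)"
      using R(2) by (rule sum_norm_le)
    also have "\<dots> = cum l J 3 s * \<bar>t\<bar> ^ 3"
      unfolding cum_def sum_distrib_right
      by (intro sum.cong) (auto simp: x_def abs_mult power_mult_distrib)
    finally have "real r * norm (\<Sum>j\<in>parts l J. R j) \<le> real r * (cum l J 3 s * \<bar>t\<bar> ^ 3)"
      by (intro mult_left_mono) auto
    thus "norm (of_nat r * (\<Sum>j\<in>parts l J. R j)) \<le> r * cum l J 3 s * \<bar>t\<bar> ^ 3"
      by (simp add: norm_mult mult.assoc)
  qed
qed

section \<open>The Jensen polynomial as an integral\<close>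

text \<open>The even moments (2m)! / (2^m m!) acquire the sign (-1)^m from the imaginary unit and
  then satisfy the recursion of \<open>herm_coeff\<close>; the odd moments vanish.\<close>

lemma gauss_moment:
  "has_bochner_integral lborel (\<lambda>u. of_real (std_normal_density u) * (\<i> * of_real u) ^ k) (of_real (herm_coeff k) :: complex)"
proof (cases "even k")
  case True
  then obtain m where k: "k = 2 * m" by auto
  have h: "herm_coeff (2 * m) = (-1) ^ m * (fact (2 * m) / (2 ^ m * fact m))"
  proof (induction m)
    case (Suc m)
    have "fact (2 * Suc m) / (2 ^ Suc m * fact (Suc m)) = real (Suc (2 * m)) * (fact (2 * m) / (2 ^ m * fact m))"
      by (simp add: divide_simps)
    moreover have "- c * ((-1) ^ m * A) = (-1) ^ Suc m * (c * A)" for c A :: real by simp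
    moreover have "herm_coeff (2 * Suc m) = - real (Suc (2 * m)) * herm_coeff (2 * m)" by simp
    ultimately show ?case unfolding Suc by metis
  qed simp
  have "has_bochner_integral lborel (\<lambda>u. (-1) ^ m * complex_of_real (std_normal_density u * u ^ (2 * m)))
      ((-1) ^ m * of_real (fact (2 * m) / (2 ^ m * fact m)))"
    by (intro has_bochner_integral_mult_right has_bochner_integral_of_real std_normal_moment_even)
  moreover have "(-1) ^ m * complex_of_real (std_normal_density u * u ^ (2 * m)) =
      of_real (std_normal_density u) * (\<i> * of_real u) ^ k" for u
    by (simp add: k power_mult_distrib power_mult power_minus[of "(complex_of_real u)\<^sup>2"])
  moreover have "(-1) ^ m * complex_of_real (fact (2 * m) / (2 ^ m * fact m)) = of_real (herm_coeff k)"
    by (simp add: k h)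
  ultimately show ?thesis by (simp only:)
next
  case False
  then obtain m where k: "k = 2 * m + 1" by (elim oddE)
  have h: "herm_coeff (2 * m + 1) = 0" by (induction m) simp_all
  have "has_bochner_integral lborel (\<lambda>u. \<i> ^ k * complex_of_real (std_normal_density u * u ^ (2 * m + 1))) (\<i> ^ k * of_real 0)"
    by (intro has_bochner_integral_mult_right has_bochner_integral_of_real std_normal_moment_odd)
  moreover have "\<i> ^ k * complex_of_real (std_normal_density u * u ^ (2 * m + 1)) =
      of_real (std_normal_density u) * (\<i> * of_real u) ^ k" for u
    by (simp only: k power_mult_distrib of_real_mult of_real_power mult_ac)
  moreover have "\<i> ^ k * complex_of_real 0 = of_real (herm_coeff k)"
    using h by (simp add: k)
  ultimately show ?thesis by (simp only:)
qed

lemma gauss_integral_herm: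
  "has_bochner_integral lborel (\<lambda>u. of_real (std_normal_density u) * (of_real y + \<i> * of_real u) ^ d)
     (complex_of_real (poly (herm d) y))"
proof -
  have "has_bochner_integral lborel (\<lambda>u. \<Sum>k\<le>d. (of_nat (d choose k) * of_real y ^ (d - k)) * (of_real (std_normal_density u) * (\<i> * of_real u) ^ k))
     (\<Sum>k\<le>d. (of_nat (d choose k) * of_real y ^ (d - k)) * complex_of_real (herm_coeff k))"
    by (intro has_bochner_integral_sum has_bochner_integral_mult_right gauss_moment)
  moreover have "(\<Sum>k\<le>d. (of_nat (d choose k) * of_real y ^ (d - k)) * (of_real (std_normal_density u) * (\<i> * of_real u) ^ k)) =
      of_real (std_normal_density u) * (of_real y + \<i> * of_real u) ^ d" for u
    unfolding add.commute[of "complex_of_real y"] binomial_ring sum_distrib_left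
    by (intro sum.cong) (auto simp: mult_ac)
  moreover have "(\<Sum>k\<le>d. (of_nat (d choose k) * of_real y ^ (d - k)) * complex_of_real (herm_coeff k)) = of_real (poly (herm d) y)"
    by (simp add: herm_def poly_sum poly_monom mult_ac)
  ultimately show ?thesis by simp
qed

section \<open>Cauchy's formula for the whole Jensen polynomial\<close>

definition gen_real :: "nat \<Rightarrow> nat \<Rightarrow> nat \<Rightarrow> real \<Rightarrow> real" where
  "gen_real l r J s = (\<Prod>j\<in>parts l J. (1 / (1 - exp (-(s * real j)))) ^ r)"

lemma gen_real_pos: "s > 0 \<Longrightarrow> gen_real l r J s > 0"
  unfolding gen_real_def by (intro prod_pos zero_less_power divide_pos_pos ballI) (auto dest: parts_pos)

lemma gen_eq_char_fun:
  assumes s: "s > 0"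
  shows "gen l r J (exp (-of_real s + \<i> * of_real t)) = of_real (gen_real l r J s) * char_fun l r J s t"
  unfolding gen_def gen_real_def char_fun_def of_real_prod prod.distrib[symmetric]
proof (rule prod.cong)
  fix j assume j: "j \<in> parts l J"
  define x where "x = exp (-(s * real j))"
  have "x < 1" using s parts_pos[OF j] by (simp add: x_def)
  hence x: "1 - complex_of_real x \<noteq> 0" by (metis eq_iff_diff_eq_0 less_irrefl of_real_eq_1_iff)
  have "exp (-of_real s + \<i> * of_real t) ^ j = exp (of_real (-(s * real j)) + \<i> * of_real (real j * t))"
    by (simp add: exp_of_nat_mult[symmetric] algebra_simps)
  also have "\<dots> = of_real x * cis (real j * t)"
    unfolding exp_add x_def exp_of_real cis_conv_exp ..
  finally have "inverse (1 - exp (-of_real s + \<i> * of_real t) ^ j) = of_real (1 / (1 - x)) * qfac x (real j * t)"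
    using x by (simp add: qfac_def divide_inverse)
  thus "inverse (1 - exp (-of_real s + \<i> * of_real t) ^ j) ^ r =
      of_real ((1 / (1 - exp (-(s * real j)))) ^ r) * qfac (exp (-(s * real j))) (real j * t) ^ r"
    by (simp only: power_mult_distrib of_real_power x_def)
qed simp

lemma poly_jensen_poly: "poly (jensen_poly a d n) z = (\<Sum>i\<le>d. of_nat (d choose i) * of_real (a (n + i)) * z ^ i)"
  by (simp add: jensen_poly_def poly_sum poly_monom)

text \<open>The Cauchy integrand in the variable u = sigma t, stripped of its positive size. The
  factor \<open>\<sigma>\<close> inside the d-th power compensates for a bracket of order 1 / sigma,
  so that this power has a nontrivial limit.\<close>

definition scaled_integrand :: "nat \<Rightarrow> nat \<Rightarrow> nat \<Rightarrow> nat \<Rightarrow> real \<Rightarrow> real \<Rightarrow> real \<Rightarrow> real \<Rightarrow> complex" where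
  "scaled_integrand l r d n s \<sigma> y u =
     char_fun l r (n + d) s (u / \<sigma>) * exp (-(\<i> * of_real (real n * (u / \<sigma>)))) *
     (of_real \<sigma> * (1 - of_real (1 - y / \<sigma>) * exp (-(\<i> * of_real (u / \<sigma>))))) ^ d"

text \<open>Adding Cauchy's formula for the coefficients n + i with weights C(d, i) X^i collapses
  the weights to (1 + X exp (s - i t))^d by the binomial theorem. The constant in front of the
  polynomial is positive, so signs are preserved.\<close>

lemma jensen_has_integral:
  assumes l: "l > 0" and s: "s > 0" and \<sigma>: "\<sigma> > 0"
  shows "(scaled_integrand l r d n s \<sigma> y has_integral
     of_real (2 * pi * \<sigma> ^ Suc d / (gen_real l r (n + d) s * exp (real n * s))) *
     poly (jensen_poly (b_coeff l r) d n) (of_real (- exp (-s) * (1 - y / \<sigma>)))) {-(pi * \<sigma>)..pi * \<sigma>}"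
proof -
  define J where "J = n + d"
  define X where "X = - exp (-s) * (1 - y / \<sigma>)"
  define G where "G = gen_real l r J s"
  have G: "G > 0" using gen_real_pos[OF s] by (simp add: G_def)
  let ?f = "\<lambda>t. gen l r J (exp (-of_real s + \<i> * of_real t))"
  let ?e = "\<lambda>t. exp (of_real s - \<i> * of_real t) :: complex"
  have coeff: "((\<lambda>t. ?f t * exp (of_nat (n + i) * (of_real s - \<i> * of_real t))) has_integral
      of_real (2 * pi) * of_real (b_coeff l r (n + i))) {-pi..pi}" if "i \<le> d" for i
  proof -
    have "b_coeff l r (n + i) = fps_nth (\<Prod>j\<in>parts l J. inverse (1 - fps_X ^ j) ^ r) (n + i)"
      using that l by (intro b_coeff_eq) (auto simp: J_def)
    thus ?thesis
      using coefficient_integral[OF gen_has_fps_expansion gen_holomorphic s, of l r J "n + i"]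
      by (simp add: mult.commute[of \<i>] del: fps_complex_prod)
  qed
  have "((\<lambda>t. \<Sum>i\<le>d. of_nat (d choose i) * of_real X ^ i * (?f t * exp (of_nat (n + i) * (of_real s - \<i> * of_real t))))
      has_integral (\<Sum>i\<le>d. of_nat (d choose i) * of_real X ^ i * (of_real (2 * pi) * of_real (b_coeff l r (n + i))))) {-pi..pi}"
    by (intro has_integral_sum has_integral_mult_right coeff) auto
  also have "(\<Sum>i\<le>d. of_nat (d choose i) * of_real X ^ i * (of_real (2 * pi) * of_real (b_coeff l r (n + i)))) =
      of_real (2 * pi) * poly (jensen_poly (b_coeff l r) d n) (of_real X)"
    unfolding poly_jensen_poly sum_distrib_left by (intro sum.cong) (auto simp: mult_ac)
  also have "(\<lambda>t. \<Sum>i\<le>d. of_nat (d choose i) * of_real X ^ i * (?f t * exp (of_nat (n + i) * (of_real s - \<i> * of_real t)))) =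
      (\<lambda>t. ?f t * exp (of_nat n * (of_real s - \<i> * of_real t)) * (of_real X * ?e t + 1) ^ d)"
  proof
    fix t
    have "exp (of_nat (n + i) * (of_real s - \<i> * of_real t)) = exp (of_nat n * (of_real s - \<i> * of_real t)) * ?e t ^ i" for i
      unfolding of_nat_add distrib_right exp_add exp_of_nat_mult[of i] ..
    thus "(\<Sum>i\<le>d. of_nat (d choose i) * of_real X ^ i * (?f t * exp (of_nat (n + i) * (of_real s - \<i> * of_real t)))) =
      ?f t * exp (of_nat n * (of_real s - \<i> * of_real t)) * (of_real X * ?e t + 1) ^ d"
      unfolding binomial_ring sum_distrib_left
      by (intro sum.cong) (auto simp: mult_ac power_mult_distrib)
  qed
  finally have int: "((\<lambda>t. ?f t * exp (of_nat n * (of_real s - \<i> * of_real t)) * (of_real X * ?e t + 1) ^ d)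
      has_integral of_real (2 * pi) * poly (jensen_poly (b_coeff l r) d n) (of_real X)) {-pi..pi}"
    (is "(?F has_integral ?I) _") .
  define F where "F = ?F"
  from has_integral_affinity'[of F ?I "-pi" pi "1 / \<sigma>" 0] int \<sigma>
  have "((\<lambda>u. F (u / \<sigma>)) has_integral of_real \<sigma> * ?I) {-(pi * \<sigma>)..pi * \<sigma>}"
    unfolding F_def[symmetric] by (simp add: scaleR_conv_of_real mult.commute)
  hence "((\<lambda>u. ?F (u / \<sigma>)) has_integral of_real \<sigma> * ?I) {-(pi * \<sigma>)..pi * \<sigma>}"
    unfolding F_def .
  from has_integral_mult_right[OF this, of "of_real (\<sigma> ^ d / (G * exp (real n * s)))"]
  have "((\<lambda>u. of_real (\<sigma> ^ d / (G * exp (real n * s))) * ?F (u / \<sigma>)) has_integral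
      of_real (\<sigma> ^ d / (G * exp (real n * s))) * (of_real \<sigma> * ?I)) {-(pi * \<sigma>)..pi * \<sigma>}" .
  also have "of_real (\<sigma> ^ d / (G * exp (real n * s))) * (of_real \<sigma> * ?I) =
     of_real (2 * pi * \<sigma> ^ Suc d / (G * exp (real n * s))) * poly (jensen_poly (b_coeff l r) d n) (of_real X)"
    by (simp add: mult_ac)
  also have "(\<lambda>u. of_real (\<sigma> ^ d / (G * exp (real n * s))) * ?F (u / \<sigma>)) = scaled_integrand l r d n s \<sigma> y"
  proof
    fix u
    define t where "t = u / \<sigma>"
    \<comment> \<open>The factor exp (-s) in the choice of X is there to cancel this exp s.\<close>
    have "?e t = of_real (exp s) * exp (-(\<i> * of_real t))"
      unfolding exp_of_real[symmetric] mult_exp_exp by simp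
    hence "of_real X * ?e t = of_real (- (exp (-s) * exp s)) * (of_real (1 - y / \<sigma>) * exp (-(\<i> * of_real t)))"
      unfolding X_def of_real_mult of_real_minus by (simp only: mult_ac mult_minus_left mult_minus_right)
    also have "exp (-s) * exp s = 1" by (simp add: mult_exp_exp)
    finally have X: "of_real X * ?e t + 1 = 1 - of_real (1 - y / \<sigma>) * exp (-(\<i> * of_real t))" by simp
    have E: "exp (of_nat n * (of_real s - \<i> * of_real t)) = of_real (exp (real n * s)) * exp (-(\<i> * of_real (real n * t)))"
      unfolding exp_of_real[symmetric] mult_exp_exp by (simp add: algebra_simps)
    have "of_real (\<sigma> ^ d / (G * exp (real n * s))) * ?F t =
      (of_real (\<sigma> ^ d / (G * exp (real n * s))) * of_real (G * exp (real n * s))) *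
      (char_fun l r J s t * exp (-(\<i> * of_real (real n * t))) * (1 - of_real (1 - y / \<sigma>) * exp (-(\<i> * of_real t))) ^ d)"
      unfolding X E gen_eq_char_fun[OF s] G_def[symmetric] of_real_mult by (simp only: mult_ac)
    also have "of_real (\<sigma> ^ d / (G * exp (real n * s))) * of_real (G * exp (real n * s)) = complex_of_real \<sigma> ^ d"
      unfolding of_real_mult[symmetric] using G by simp
    finally show "of_real (\<sigma> ^ d / (G * exp (real n * s))) * ?F (u / \<sigma>) = scaled_integrand l r d n s \<sigma> y u"
      unfolding scaled_integrand_def t_def[symmetric] J_def[symmetric] power_mult_distrib
      by (simp only: mult_ac)
  qed
  finally show ?thesis unfolding X_def G_def J_def .
qed

lemma continuous_on_char_fun:
  assumes "s > 0"
  shows "continuous_on A (char_fun l r J s)"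
proof -
  have "1 - complex_of_real (exp (-(s * real j))) * cis (real j * t) \<noteq> 0" if j: "j \<in> parts l J" for j t
  proof
    assume "1 - complex_of_real (exp (-(s * real j))) * cis (real j * t) = 0"
    hence "norm (complex_of_real (exp (-(s * real j))) * cis (real j * t)) = norm (1::complex)" by simp
    thus False using assms parts_pos[OF j] by (simp add: norm_mult)
  qed
  thus ?thesis unfolding char_fun_def qfac_def cis_conv_exp by (intro continuous_intros) auto
qed

lemma continuous_on_scaled_integrand:
  assumes "s > 0" "\<sigma> > 0"
  shows "continuous_on A (scaled_integrand l r d n s \<sigma> y)"
  unfolding scaled_integrand_def
  by (intro continuous_intros continuous_on_compose2[OF continuous_on_char_fun[OF assms(1), of UNIV]])
     (use assms in auto)

text \<open>Restated as a Lebesgue integral over the whole line with an indicator, the form that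
  dominated convergence requires while the interval grows.\<close>

lemma jensen_lebesgue_integral:
  assumes l: "l > 0" and s: "s > 0" and \<sigma>: "\<sigma> > 0"
  shows "(LINT u|lborel. indicator {-(pi * \<sigma>)..pi * \<sigma>} u *\<^sub>R scaled_integrand l r d n s \<sigma> y u) =
     of_real (2 * pi * \<sigma> ^ Suc d / (gen_real l r (n + d) s * exp (real n * s))) *
     poly (jensen_poly (b_coeff l r) d n) (of_real (- exp (-s) * (1 - y / \<sigma>)))"
proof -
  have "set_integrable lborel {-(pi * \<sigma>)..pi * \<sigma>} (scaled_integrand l r d n s \<sigma> y)"
    by (rule borel_integrable_atLeastAtMost'[OF continuous_on_scaled_integrand[OF s \<sigma>]])
  from set_borel_integral_eq_integral(2)[OF this] show ?thesis
    using integral_unique[OF jensen_has_integral[OF l s \<sigma>, of r d n y]]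
    by (simp add: set_lebesgue_integral_def)
qed

lemma integrable_inverse_one_plus_square: "integrable lborel (\<lambda>x::real. inverse (1 + x\<^sup>2))"
  using integrable_inverse_1_plus_square by (simp add: set_integrable_def)

text \<open>With E = exp (-i u / sigma) the quantity is sigma (1 - E) + y E, of modulus at most |u|
  + |y| for every sigma. The bound is stated in powers of 1 + u^2 to match the decay of the
  characteristic function.\<close>

lemma norm_tilt_factor_le:
  assumes \<sigma>: "\<sigma> > 0"
  shows "norm (of_real \<sigma> * (1 - of_real (1 - y / \<sigma>) * exp (-(\<i> * of_real (u / \<sigma>))))) \<le> (1 + \<bar>y\<bar>) * (1 + u\<^sup>2)"
proof -
  let ?E = "exp (-(\<i> * of_real (u / \<sigma>)))"
  have E: "norm ?E = 1" by (simp add: norm_exp_eq_Re)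
  have "of_real \<sigma> * (1 - of_real (1 - y / \<sigma>) * ?E) = of_real \<sigma> * (1 - ?E) + of_real y * ?E"
    using \<sigma> by (simp add: algebra_simps)
  also have "norm \<dots> \<le> norm (of_real \<sigma> * (1 - ?E)) + norm (of_real y * ?E)" by (rule norm_triangle_ineq)
  also have "\<dots> = \<sigma> * norm (?E - 1) + \<bar>y\<bar>"
    using \<sigma> E by (simp add: norm_mult norm_minus_commute)
  also have "norm (?E - 1) = norm (iexp (-(u / \<sigma>)) - 1)" by simp
  also have "\<dots> \<le> \<bar>u / \<sigma>\<bar>"
    using iexp_approx1[of "-(u / \<sigma>)" 0] by simp
  also have "\<sigma> * \<bar>u / \<sigma>\<bar> = \<bar>u\<bar>" using \<sigma> by (simp add: abs_divide)
  finally have "norm (of_real \<sigma> * (1 - of_real (1 - y / \<sigma>) * ?E)) \<le> \<bar>u\<bar> + \<bar>y\<bar>" using \<sigma> by simp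
  also have "\<bar>u\<bar> \<le> 1 + u\<^sup>2"
    using zero_le_power2[of "\<bar>u\<bar> - 1 / 2"] by (simp add: power2_eq_square algebra_simps)
  also have "1 + u\<^sup>2 + \<bar>y\<bar> \<le> (1 + \<bar>y\<bar>) * (1 + u\<^sup>2)" by (simp add: algebra_simps)
  finally show ?thesis by simp
qed

text \<open>The same splitting: sigma (1 - E) is minus a difference quotient of exp (-i u h) at h =
  0 with step 1 / sigma.\<close>

lemma tilt_factor_tendsto:
  fixes \<sigma> :: "nat \<Rightarrow> real"
  assumes \<sigma>: "\<And>n. \<sigma> n > 0" "filterlim \<sigma> at_top sequentially"
  shows "(\<lambda>n. of_real (\<sigma> n) * (1 - of_real (1 - y / \<sigma> n) * exp (-(\<i> * of_real (u / \<sigma> n))))) \<longlonglongrightarrow>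
           of_real y + \<i> * of_real u"
proof -
  have inv: "(\<lambda>n. complex_of_real (inverse (\<sigma> n))) \<longlonglongrightarrow> 0"
    using tendsto_of_real[OF tendsto_inverse_0_at_top[OF \<sigma>(2)], where ?'a = complex] by simp
  have "((\<lambda>z. exp (-(\<i> * of_real u) * z)) has_field_derivative (-(\<i> * of_real u))) (at 0)"
    by (auto intro!: derivative_eq_intros)
  hence "((\<lambda>h. (exp (-(\<i> * of_real u) * h) - 1) / h) \<longlongrightarrow> -(\<i> * of_real u)) (at 0)"
    by (simp add: DERIV_def)
  hence "(\<lambda>n. (exp (-(\<i> * of_real u) * complex_of_real (inverse (\<sigma> n))) - 1) / complex_of_real (inverse (\<sigma> n))) \<longlonglongrightarrow> -(\<i> * of_real u)"
    by (rule filterlim_compose) (use inv \<sigma>(1) in \<open>auto simp: filterlim_at less_imp_neq[symmetric]\<close>)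
  moreover have "(\<lambda>n. exp (-(\<i> * of_real u) * complex_of_real (inverse (\<sigma> n)))) \<longlonglongrightarrow> exp (-(\<i> * of_real u) * 0)"
    using inv by (intro tendsto_intros)
  ultimately have "(\<lambda>n. of_real y * exp (-(\<i> * of_real u) * complex_of_real (inverse (\<sigma> n))) -
      (exp (-(\<i> * of_real u) * complex_of_real (inverse (\<sigma> n))) - 1) / complex_of_real (inverse (\<sigma> n))) \<longlonglongrightarrow>
      of_real y * exp (-(\<i> * of_real u) * 0) - -(\<i> * of_real u)"
    by (intro tendsto_diff tendsto_mult tendsto_const)
  moreover have "of_real y * exp (-(\<i> * of_real u) * complex_of_real (inverse (\<sigma> n))) -
      (exp (-(\<i> * of_real u) * complex_of_real (inverse (\<sigma> n))) - 1) / complex_of_real (inverse (\<sigma> n)) =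
      of_real (\<sigma> n) * (1 - of_real (1 - y / \<sigma> n) * exp (-(\<i> * of_real (u / \<sigma> n))))" for n
  proof -
    have "complex_of_real (\<sigma> n) \<noteq> 0" using \<sigma>(1)[of n] by simp
    thus ?thesis by (simp add: field_simps)
  qed
  ultimately show ?thesis by simp
qed

section \<open>The limit\<close>

lemma cum_pos:
  assumes "l \<ge> 2" "J \<ge> 1" "s > 0"
  shows "cum l J m s > 0"
  unfolding cum_def
proof (rule sum_pos)
  have "1 \<in> parts l J" using assms by (simp add: parts_def)
  thus "parts l J \<noteq> {}" by blast
next
  fix j assume "j \<in> parts l J"
  hence "j > 0" by (rule parts_pos)
  thus "0 < real j ^ m * exp (-(s * real j)) / (1 - exp (-(s * real j))) ^ m"
    using assms by (intro divide_pos_pos mult_pos_pos zero_less_power) auto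
qed simp

text \<open>Dominated convergence, with s the saddle point, at which the mean is n, and sigma^2 the
  variance. The linear phase then cancels and the quadratic term becomes exactly u^2 / 2.\<close>

lemma scaled_integral_tendsto:
  assumes l: "l \<ge> 2" and r: "r \<ge> 1" and d: "d \<ge> 1"
  obtains s \<sigma> :: "nat \<Rightarrow> real" where "\<And>n. s n > 0" "\<And>n. \<sigma> n > 0"
    "\<And>y. (\<lambda>n. LINT u|lborel. indicator {-(pi * \<sigma> n)..pi * \<sigma> n} u *\<^sub>R scaled_integrand l r d n (s n) (\<sigma> n) y u)
       \<longlonglongrightarrow> of_real (sqrt (2 * pi) * poly (herm d) y)"
proof -
  \<comment> \<open>At n = 0 nothing but positivity is required and the value 1 is taken, so that
    both sequences are positive at every index.\<close>
  have "\<exists>s>0. n \<ge> 1 \<longrightarrow> 1 / (real n + 1) \<le> s \<and> s \<le> 2 * sqrt (real r / real n) \<and> real r * cum l (n + d) 1 s = real n" for n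
  proof (cases "n \<ge> 1")
    case True
    with ex_saddle_point[OF l r True, of "n + d"] obtain s where
      s: "1 / (real n + 1) \<le> s" "s \<le> 2 * sqrt (real r / real n)" "real r * cum l (n + d) 1 s = real n"
      using d by auto
    have "0 < 1 / (real n + 1)" by simp
    hence "s > 0" using s by linarith
    thus ?thesis using s by blast
  qed (auto intro: exI[of _ 1])
  then obtain s where s_pos: "\<And>n. s n > 0" and
     s: "\<And>n. n \<ge> 1 \<Longrightarrow> 1 / (real n + 1) \<le> s n \<and> s n \<le> 2 * sqrt (real r / real n) \<and> real r * cum l (n + d) 1 (s n) = real n"
    by metis
  define \<sigma> where "\<sigma> = (\<lambda>n. sqrt (real r * cum l (n + d) 2 (s n)))"
  have c2_pos: "real r * cum l (n + d) 2 (s n) > 0" for n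
    using cum_pos[OF l _ s_pos, of "n + d"] r d by simp
  hence \<sigma>_pos: "\<sigma> n > 0" and \<sigma>_sq: "(\<sigma> n)\<^sup>2 = real r * cum l (n + d) 2 (s n)" for n
    by (simp_all add: \<sigma>_def less_imp_le)
  have J: "1 / s n \<le> real (n + d)" if "n \<ge> 1" for n
  proof -
    have "1 / s n \<le> 1 / (1 / (real n + 1))"
      using s[OF that] s_pos[of n] by (intro divide_left_mono) auto
    also have "\<dots> \<le> real (n + d)" using d by simp
    finally show ?thesis .
  qed
  have s_0: "s \<longlonglongrightarrow> 0"
  proof (rule tendsto_sandwich[of "\<lambda>_. 0"])
    have "(\<lambda>n. 2 * sqrt (real r / real n)) \<longlonglongrightarrow> 2 * sqrt 0"
      by (intro tendsto_mult tendsto_const tendsto_real_sqrt lim_const_over_n)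
    thus "(\<lambda>n. 2 * sqrt (real r / real n)) \<longlonglongrightarrow> 0" by simp
    show "eventually (\<lambda>n. s n \<le> 2 * sqrt (real r / real n)) sequentially"
      using eventually_ge_at_top[of 1] by eventually_elim (use s in blast)
  qed (use s_pos in \<open>auto intro: always_eventually less_imp_le\<close>)
  have s_small: "eventually (\<lambda>n. s n < e) sequentially" if "e > 0" for e
    using order_tendstoD(2)[OF s_0 that] .
  \<comment> \<open>Here 32 = 2 * 4^2 comes from \<open>cum_le\<close>. The bound makes t^2 / s^3 at
    least u^2 / (32 r), which turns decay in t into decay in u.\<close>
  have \<sigma>_le: "(\<sigma> n)\<^sup>2 * s n ^ 3 \<le> 32 * real r" for n
  proof -
    have "cum l (n + d) 2 (s n) \<le> 2 * (2 * real 2) ^ 2 / s n ^ Suc 2" by (intro cum_le s_pos) simp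
    hence "cum l (n + d) 2 (s n) * s n ^ 3 \<le> 32" using s_pos[of n] by (simp add: field_simps)
    hence "real r * (cum l (n + d) 2 (s n) * s n ^ 3) \<le> real r * 32" by (rule mult_left_mono) simp
    thus ?thesis unfolding \<sigma>_sq mult.assoc by linarith
  qed
  have \<sigma>_ge: "eventually (\<lambda>n. (\<sigma> n)\<^sup>2 \<ge> 1 / (6 * real l * s n ^ 3)) sequentially"
    using s_small[OF half_gt_zero[OF zero_less_one]] eventually_ge_at_top[of 1]
  proof eventually_elim
    case (elim n)
    hence "1 / (6 * real l * s n ^ 3) \<le> cum l (n + d) 2 (s n)"
      using J[of n] s_pos[of n] by (intro cum_2_ge l) auto
    also have "\<dots> \<le> real r * cum l (n + d) 2 (s n)"
      using r mult_right_mono[of 1 "real r" "cum l (n + d) 2 (s n)"] cum_nonneg[OF s_pos] by simp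
    finally show ?case by (simp add: \<sigma>_sq)
  qed
  have \<sigma>_top: "filterlim \<sigma> at_top sequentially"
  proof -
    have "(\<lambda>n. 6 * real l * s n ^ 3) \<longlonglongrightarrow> 6 * real l * 0 ^ 3" by (intro tendsto_intros s_0)
    hence "filterlim (\<lambda>n. inverse (6 * real l * s n ^ 3)) at_top sequentially"
      using s_pos l by (intro filterlim_inverse_at_top) (auto intro!: always_eventually)
    hence "filterlim (\<lambda>n. sqrt (inverse (6 * real l * s n ^ 3))) at_top sequentially"
      by (rule filterlim_compose[OF sqrt_at_top])
    moreover have "eventually (\<lambda>n. sqrt (inverse (6 * real l * s n ^ 3)) \<le> \<sigma> n) sequentially"
      using \<sigma>_ge by eventually_elim (use \<sigma>_pos in \<open>simp add: real_le_lsqrt less_imp_le inverse_eq_divide\<close>)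
    ultimately show ?thesis by (rule filterlim_at_top_mono)
  qed
  \<comment> \<open>The cubic remainder is at most a multiple of s^(-4) |u|^3 / sigma^3; as sigma is
    at least of order s^(-3/2), it is O(sqrt s). The comparison is carried out on squares.\<close>
  have err: "(\<lambda>n. 1 / (s n ^ 4 * \<sigma> n ^ 3)) \<longlonglongrightarrow> 0"
  proof (rule tendsto_sandwich[of "\<lambda>_. 0"])
    have "(\<lambda>n. sqrt ((6 * real l) ^ 3 * s n)) \<longlonglongrightarrow> sqrt ((6 * real l) ^ 3 * 0)" by (intro tendsto_intros s_0)
    thus "(\<lambda>n. sqrt ((6 * real l) ^ 3 * s n)) \<longlonglongrightarrow> 0" by simp
    show "eventually (\<lambda>n. 1 / (s n ^ 4 * \<sigma> n ^ 3) \<le> sqrt ((6 * real l) ^ 3 * s n)) sequentially"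
      using \<sigma>_ge
    proof eventually_elim
      case (elim n)
      have "(1 / (6 * real l * s n ^ 3)) ^ 3 \<le> ((\<sigma> n)\<^sup>2) ^ 3"
        using elim s_pos[of n] by (intro power_mono) auto
      hence "s n ^ 8 * (1 / (6 * real l * s n ^ 3)) ^ 3 \<le> s n ^ 8 * ((\<sigma> n)\<^sup>2) ^ 3"
        using s_pos[of n] by (intro mult_left_mono) auto
      hence "1 / (s n ^ 8 * ((\<sigma> n)\<^sup>2) ^ 3) \<le> 1 / (s n ^ 8 * (1 / (6 * real l * s n ^ 3)) ^ 3)"
        using s_pos[of n] \<sigma>_pos[of n] l
        by (intro divide_left_mono mult_pos_pos zero_less_power divide_pos_pos) auto
      also have "\<dots> = (6 * real l) ^ 3 * s n"
        using s_pos[of n] l by (simp add: field_simps eval_nat_numeral)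
      also have "1 / (s n ^ 8 * ((\<sigma> n)\<^sup>2) ^ 3) = (1 / (s n ^ 4 * \<sigma> n ^ 3))\<^sup>2"
        by (simp add: power_mult_distrib power_divide flip: power_mult)
      finally show ?case by (rule real_le_rsqrt)
    qed
    have "0 \<le> 1 / (s n ^ 4 * \<sigma> n ^ 3)" for n
      using s_pos[of n] \<sigma>_pos[of n] by simp
    thus "eventually (\<lambda>n. 0 \<le> 1 / (s n ^ 4 * \<sigma> n ^ 3)) sequentially" by simp
  qed simp

  have pointwise: "(\<lambda>n. indicator {-(pi * \<sigma> n)..pi * \<sigma> n} u *\<^sub>R scaled_integrand l r d n (s n) (\<sigma> n) y u)
      \<longlonglongrightarrow> of_real (exp (- u\<^sup>2 / 2)) * (of_real y + \<i> * of_real u) ^ d" for u y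
  proof -
    have "\<exists>R. char_fun l r (n + d) (s n) (u / \<sigma> n) * exp (-(\<i> * of_real (real n * (u / \<sigma> n)))) = of_real (exp (- u\<^sup>2 / 2)) * exp R \<and>
        norm R \<le> 432 * real r * \<bar>u\<bar> ^ 3 * (1 / (s n ^ 4 * \<sigma> n ^ 3))" if n: "n \<ge> 1" for n
    proof -
      obtain R where R: "char_fun l r (n + d) (s n) (u / \<sigma> n) =
          exp (\<i> * of_real (r * cum l (n + d) 1 (s n) * (u / \<sigma> n)) - of_real (r * cum l (n + d) 2 (s n) * (u / \<sigma> n)\<^sup>2 / 2) + R)"
         "norm R \<le> r * cum l (n + d) 3 (s n) * \<bar>u / \<sigma> n\<bar> ^ 3"
        using char_fun_expansion[OF s_pos] by metis
      have "r * cum l (n + d) 2 (s n) * (u / \<sigma> n)\<^sup>2 / 2 = u\<^sup>2 / 2"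
        unfolding \<sigma>_sq[symmetric] using \<sigma>_pos[of n] by (simp add: power_divide)
      moreover have "r * cum l (n + d) 1 (s n) = real n" using s[OF n] by simp
      ultimately have "char_fun l r (n + d) (s n) (u / \<sigma> n) =
          exp (\<i> * of_real (real n * (u / \<sigma> n)) - of_real (u\<^sup>2 / 2) + R)" using R(1) by simp
      hence "char_fun l r (n + d) (s n) (u / \<sigma> n) * exp (-(\<i> * of_real (real n * (u / \<sigma> n)))) = exp (of_real (- u\<^sup>2 / 2) + R)"
        by (simp add: mult_exp_exp)
      also have "\<dots> = of_real (exp (- u\<^sup>2 / 2)) * exp R" unfolding exp_add exp_of_real ..
      finally have 1: "char_fun l r (n + d) (s n) (u / \<sigma> n) * exp (-(\<i> * of_real (real n * (u / \<sigma> n)))) = of_real (exp (- u\<^sup>2 / 2)) * exp R" .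
      have "cum l (n + d) 3 (s n) \<le> 2 * (2 * real 3) ^ 3 / s n ^ Suc 3" by (intro cum_le s_pos) simp
      hence "cum l (n + d) 3 (s n) \<le> 432 / s n ^ 4" by simp
      hence "r * cum l (n + d) 3 (s n) * \<bar>u / \<sigma> n\<bar> ^ 3 \<le> r * (432 / s n ^ 4) * \<bar>u / \<sigma> n\<bar> ^ 3"
        by (intro mult_right_mono mult_left_mono) auto
      also have "\<dots> = 432 * real r * \<bar>u\<bar> ^ 3 * (1 / (s n ^ 4 * \<sigma> n ^ 3))"
        using \<sigma>_pos[of n] by (simp add: abs_divide power_divide mult_ac)
      finally show ?thesis using 1 R(2) by fastforce
    qed
    then obtain R where R: "\<And>n. n \<ge> 1 \<Longrightarrow> char_fun l r (n + d) (s n) (u / \<sigma> n) * exp (-(\<i> * of_real (real n * (u / \<sigma> n)))) = of_real (exp (- u\<^sup>2 / 2)) * exp (R n)"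
        "\<And>n. n \<ge> 1 \<Longrightarrow> norm (R n) \<le> 432 * real r * \<bar>u\<bar> ^ 3 * (1 / (s n ^ 4 * \<sigma> n ^ 3))"
      by metis
    have "(\<lambda>n. 432 * real r * \<bar>u\<bar> ^ 3 * (1 / (s n ^ 4 * \<sigma> n ^ 3))) \<longlonglongrightarrow> 432 * real r * \<bar>u\<bar> ^ 3 * 0"
      by (intro tendsto_mult tendsto_const err)
    hence "(\<lambda>n. 432 * real r * \<bar>u\<bar> ^ 3 * (1 / (s n ^ 4 * \<sigma> n ^ 3))) \<longlonglongrightarrow> 0" by simp
    moreover have "eventually (\<lambda>n. norm (R n) \<le> 432 * real r * \<bar>u\<bar> ^ 3 * (1 / (s n ^ 4 * \<sigma> n ^ 3))) sequentially"
      using eventually_ge_at_top[of 1] by eventually_elim (rule R(2))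
    ultimately have "R \<longlonglongrightarrow> 0" by (rule Lim_null_comparison[rotated])
    hence "(\<lambda>n. of_real (exp (- u\<^sup>2 / 2)) * exp (R n) *
        (of_real (\<sigma> n) * (1 - of_real (1 - y / \<sigma> n) * exp (-(\<i> * of_real (u / \<sigma> n))))) ^ d) \<longlonglongrightarrow>
        of_real (exp (- u\<^sup>2 / 2)) * exp 0 * (of_real y + \<i> * of_real u) ^ d"
      by (intro tendsto_mult tendsto_const tendsto_exp tendsto_power tilt_factor_tendsto \<sigma>_pos \<sigma>_top)
    hence lim: "(\<lambda>n. of_real (exp (- u\<^sup>2 / 2)) * exp (R n) *
        (of_real (\<sigma> n) * (1 - of_real (1 - y / \<sigma> n) * exp (-(\<i> * of_real (u / \<sigma> n))))) ^ d) \<longlonglongrightarrow>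
        of_real (exp (- u\<^sup>2 / 2)) * (of_real y + \<i> * of_real u) ^ d" by simp
    have "eventually (\<lambda>n. of_real (exp (- u\<^sup>2 / 2)) * exp (R n) *
        (of_real (\<sigma> n) * (1 - of_real (1 - y / \<sigma> n) * exp (-(\<i> * of_real (u / \<sigma> n))))) ^ d =
        indicator {-(pi * \<sigma> n)..pi * \<sigma> n} u *\<^sub>R scaled_integrand l r d n (s n) (\<sigma> n) y u) sequentially"
      \<comment> \<open>For fixed u the growing interval eventually contains u, and the indicator
        becomes 1.\<close>
      using eventually_ge_at_top[of 1] filterlim_at_top[THEN iffD1, OF \<sigma>_top, rule_format, of "\<bar>u\<bar>"]
    proof eventually_elim
      case (elim n)
      have "\<bar>u\<bar> \<le> 1 * \<sigma> n" using elim by simp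
      also have "\<dots> \<le> pi * \<sigma> n" using \<sigma>_pos[of n] pi_gt3 by (intro mult_right_mono) auto
      finally have "u \<in> {-(pi * \<sigma> n)..pi * \<sigma> n}" by auto
      thus ?case unfolding scaled_integrand_def R(1)[OF elim(1)] by simp
    qed
    from Lim_transform_eventually[OF lim this] show ?thesis .
  qed

  \<comment> \<open>After the square root there remain d + 1 powers of 1 / (1 + u^2): d of them
    absorb the tilt factor and the last one is integrable.\<close>
  define P where "P = 2 * Suc d"
  have "P \<ge> 1" by (simp add: P_def)
  then obtain C s0 where C: "C > 0" "s0 > 0"
    "\<And>r J s t. \<lbrakk>r \<ge> 1; 0 < s; s < s0; 1 / s \<le> real J; \<bar>t\<bar> \<le> pi\<rbrakk> \<Longrightarrow>
       (norm (char_fun l r J s t))\<^sup>2 \<le> C / (1 + t\<^sup>2 / s ^ 3) ^ P"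
    using char_fun_dominated[OF l] by metis
  define D where "D = sqrt C * (32 * real r) ^ Suc d"
  have D: "D \<ge> 0" using C by (simp add: D_def)
  obtain N where N: "\<And>n. n \<ge> N \<Longrightarrow> n \<ge> 1 \<and> s n < s0"
    using eventually_conj[OF eventually_ge_at_top[of 1] s_small[OF C(2)]] unfolding eventually_sequentially by auto
  have dominated: "norm (indicator {-(pi * \<sigma> n)..pi * \<sigma> n} u *\<^sub>R scaled_integrand l r d n (s n) (\<sigma> n) y u)
      \<le> D * (1 + \<bar>y\<bar>) ^ d * inverse (1 + u\<^sup>2)" if n: "n \<ge> N" for n u y
  proof (cases "u \<in> {-(pi * \<sigma> n)..pi * \<sigma> n}")
    case False
    have "0 \<le> D * (1 + \<bar>y\<bar>) ^ d * inverse (1 + u\<^sup>2)" using D by simp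
    thus ?thesis using False by simp
  next
    case True
    define v where "v = 1 + u\<^sup>2"
    have v: "v > 0" unfolding v_def by (intro add_pos_nonneg) auto
    define t where "t = u / \<sigma> n"
    have t: "\<bar>t\<bar> \<le> pi" using True \<sigma>_pos[of n] by (auto simp: t_def abs_divide field_simps abs_le_iff)
    have "v / (32 * real r) \<le> 1 + t\<^sup>2 / s n ^ 3"
    proof -
      have "u\<^sup>2 / (32 * real r) \<le> u\<^sup>2 / ((\<sigma> n)\<^sup>2 * s n ^ 3)"
        using \<sigma>_le[of n] \<sigma>_pos[of n] s_pos[of n] r by (intro divide_left_mono mult_pos_pos zero_less_power) auto
      also have "\<dots> = t\<^sup>2 / s n ^ 3" by (simp add: t_def power_divide)
      finally have "u\<^sup>2 / (32 * real r) \<le> t\<^sup>2 / s n ^ 3" .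
      moreover have "1 / (32 * real r) \<le> 1" using r by simp
      ultimately show ?thesis unfolding v_def add_divide_distrib by linarith
    qed
    hence "(v / (32 * real r)) ^ P \<le> (1 + t\<^sup>2 / s n ^ 3) ^ P"
      using v by (intro power_mono) auto
    moreover have "(v / (32 * real r)) ^ P > 0" using v r by simp
    ultimately have "C / (1 + t\<^sup>2 / s n ^ 3) ^ P \<le> C / (v / (32 * real r)) ^ P"
      using C by (intro divide_left_mono) (auto intro!: mult_pos_pos)
    moreover have "(norm (char_fun l r (n + d) (s n) t))\<^sup>2 \<le> C / (1 + t\<^sup>2 / s n ^ 3) ^ P"
      using N[OF n] J[of n] t by (intro C r s_pos) auto
    moreover have "C / (v / (32 * real r)) ^ P = (D / v ^ Suc d)\<^sup>2"
      unfolding P_def D_def power_mult_distrib power_divide power_mult[symmetric] mult.commute[of "Suc d" 2]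
      using C by (simp add: power_divide)
    ultimately have "(norm (char_fun l r (n + d) (s n) t))\<^sup>2 \<le> (D / v ^ Suc d)\<^sup>2" by linarith
    hence ch: "norm (char_fun l r (n + d) (s n) t) \<le> D / v ^ Suc d"
      by (rule power2_le_imp_le) (use D v in auto)
    have E: "norm (exp (-(\<i> * of_real (real n * t)))) = 1" by (simp add: norm_exp_eq_Re)
    have "norm (scaled_integrand l r d n (s n) (\<sigma> n) y u) =
       norm (char_fun l r (n + d) (s n) t) * norm (of_real (\<sigma> n) * (1 - of_real (1 - y / \<sigma> n) * exp (-(\<i> * of_real (u / \<sigma> n))))) ^ d"
      unfolding scaled_integrand_def t_def[symmetric] norm_mult[of _ "_ ^ d"] norm_power
      using E by (simp add: norm_mult)
    also have "\<dots> \<le> D / v ^ Suc d * ((1 + \<bar>y\<bar>) * v) ^ d"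
      unfolding v_def by (intro mult_mono power_mono norm_tilt_factor_le \<sigma>_pos ch[unfolded v_def]) (use D v in \<open>auto simp: v_def\<close>)
    also have "\<dots> = D * (1 + \<bar>y\<bar>) ^ d * inverse v"
      unfolding power_mult_distrib using v by (simp add: divide_simps)
    finally show ?thesis using True by (simp add: v_def)
  qed

  have "(\<lambda>n. LINT u|lborel. indicator {-(pi * \<sigma> n)..pi * \<sigma> n} u *\<^sub>R scaled_integrand l r d n (s n) (\<sigma> n) y u)
       \<longlonglongrightarrow> of_real (sqrt (2 * pi) * poly (herm d) y)" for y
  proof -
    let ?F = "\<lambda>n u. indicator {-(pi * \<sigma> n)..pi * \<sigma> n} u *\<^sub>R scaled_integrand l r d n (s n) (\<sigma> n) y u"
    let ?f = "\<lambda>u. of_real (exp (- u\<^sup>2 / 2)) * (of_real y + \<i> * of_real u) ^ d"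
    have meas: "?F n \<in> borel_measurable lborel" for n
    proof -
      have "scaled_integrand l r d n (s n) (\<sigma> n) y \<in> borel_measurable borel"
        by (rule borel_measurable_continuous_onI[OF continuous_on_scaled_integrand[OF s_pos \<sigma>_pos]])
      thus ?thesis by simp
    qed
    \<comment> \<open>The domination holds only from \<open>N\<close> on, so the sequence is shifted
      before the convergence theorem is applied and shifted back afterwards.\<close>
    have "(\<lambda>n. integral\<^sup>L lborel (?F (n + N))) \<longlonglongrightarrow> integral\<^sup>L lborel ?f"
    proof (rule integral_dominated_convergence[where w = "\<lambda>u. D * (1 + \<bar>y\<bar>) ^ d * inverse (1 + u\<^sup>2)"])
      show "?f \<in> borel_measurable lborel" by simp
      show "integrable lborel (\<lambda>u. D * (1 + \<bar>y\<bar>) ^ d * inverse (1 + u\<^sup>2))"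
        by (intro integrable_mult_right integrable_inverse_one_plus_square)
      show "AE u in lborel. (\<lambda>n. ?F (n + N) u) \<longlonglongrightarrow> ?f u"
        by (intro AE_I2 LIMSEQ_ignore_initial_segment pointwise)
      show "AE u in lborel. norm (?F (n + N) u) \<le> D * (1 + \<bar>y\<bar>) ^ d * inverse (1 + u\<^sup>2)" for n
        by (intro AE_I2 dominated) simp
    qed (rule meas)
    hence "(\<lambda>n. integral\<^sup>L lborel (?F n)) \<longlonglongrightarrow> integral\<^sup>L lborel ?f"
      by (rule LIMSEQ_offset)
    moreover have "integral\<^sup>L lborel ?f = of_real (sqrt (2 * pi) * poly (herm d) y)"
    proof -
      have "has_bochner_integral lborel (\<lambda>u. complex_of_real (sqrt (2 * pi)) * (of_real (std_normal_density u) * (of_real y + \<i> * of_real u) ^ d))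
         (complex_of_real (sqrt (2 * pi)) * of_real (poly (herm d) y))"
        by (intro has_bochner_integral_mult_right gauss_integral_herm)
      moreover have "complex_of_real (sqrt (2 * pi)) * (of_real (std_normal_density u) * (of_real y + \<i> * of_real u) ^ d) = ?f u" for u
      proof -
        have "sqrt (2 * pi) * std_normal_density u = exp (- u\<^sup>2 / 2)" by (simp add: std_normal_density_def)
        thus ?thesis by (metis mult.assoc of_real_mult)
      qed
      ultimately show ?thesis by (simp add: has_bochner_integral_integral_eq)
    qed
    ultimately show ?thesis by simp
  qed
  from that[of s \<sigma>, OF s_pos \<sigma>_pos this] show ?thesis .
qed

theorem theorem2p6:
  fixes r l d :: nat
  assumes "r \<ge> 1" and "l \<ge> 2" and "d \<ge> 1"
  shows "finite {n. \<not> hyperbolic (jensen_poly (b_coeff l r) d n)}"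
proof -
  obtain s \<sigma> :: "nat \<Rightarrow> real" where s: "\<And>n. s n > 0" and \<sigma>: "\<And>n. \<sigma> n > 0" and
    lim: "\<And>y. (\<lambda>n. LINT u|lborel. indicator {-(pi * \<sigma> n)..pi * \<sigma> n} u *\<^sub>R scaled_integrand l r d n (s n) (\<sigma> n) y u)
       \<longlonglongrightarrow> of_real (sqrt (2 * pi) * poly (herm d) y)"
    using scaled_integral_tendsto[OF assms(2,1,3)] by blast
  define p where "p = jensen_poly (b_coeff l r) d"
  define A where "A = (\<lambda>n. 2 * pi * \<sigma> n ^ Suc d / (gen_real l r (n + d) (s n) * exp (real n * s n)))"
  define X where "X = (\<lambda>n y. - exp (- s n) * (1 - y / \<sigma> n))"
  \<comment> \<open>A real version of the rescaled Jensen polynomial, as a function of y, to which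
    the intermediate value theorem applies.\<close>
  define F where "F = (\<lambda>n y. A n * (\<Sum>i\<le>d. real (d choose i) * b_coeff l r (n + i) * X n y ^ i))"
  have A: "A n > 0" for n
    unfolding A_def using \<sigma>[of n] gen_real_pos[OF s] by simp
  have F: "complex_of_real (F n y) = of_real (A n) * poly (p n) (of_real (X n y))" for n y
    by (simp add: F_def p_def poly_jensen_poly)
  have "l > 0" using assms(2) by simp
  have "(\<lambda>n. complex_of_real (F n y)) \<longlonglongrightarrow> of_real (sqrt (2 * pi) * poly (herm d) y)" for y
    using lim[of y] unfolding jensen_lebesgue_integral[OF \<open>l > 0\<close> s \<sigma>] F A_def X_def p_def .
  hence F_lim: "(\<lambda>n. F n y) \<longlonglongrightarrow> sqrt (2 * pi) * poly (herm d) y" for y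
    by (simp only: tendsto_of_real_iff)
  obtain y where "alternates d y (poly (herm d))" using herm_alternates by blast
  hence "alternates d y (\<lambda>y. sqrt (2 * pi) * poly (herm d) y)"
    by (simp add: alternates_def mult.left_commute[of _ "sqrt (2 * pi)"])
  hence "eventually (\<lambda>n. alternates d y (F n)) sequentially"
    by (rule tendsto_alternates) (rule F_lim)
  hence "eventually (\<lambda>n. hyperbolic (p n)) sequentially"
  proof eventually_elim
    case (elim n)
    have "continuous_on UNIV (F n)" unfolding F_def X_def using \<sigma>[of n] by (intro continuous_intros) auto
    from alternates_roots[OF elim this] obtain z where z: "inj_on z {..<d}" "\<And>i. i < d \<Longrightarrow> F n (z i) = 0"
      by blast
    show ?case
    proof (rule hyperbolic_if_real_roots[where z = "\<lambda>i. X n (z i)"])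
      show "degree (p n) \<le> d"
        unfolding p_def jensen_poly_def
        by (intro degree_sum_le) (auto intro: order.trans[OF degree_monom_le])
      \<comment> \<open>The definition of \<open>hyperbolic\<close> excludes the zero polynomial; a
        strict sign at one alternation point rules it out.\<close>
      have "F n (y 0) \<noteq> 0" using elim by (force simp: alternates_def)
      thus "p n \<noteq> 0" using F[of n "y 0"] by auto
      \<comment> \<open>The substitution from y to X is affine with nonzero slope, so distinct roots
        in y give distinct real roots of the Jensen polynomial.\<close>
      show "inj_on (\<lambda>i. X n (z i)) {..<d}"
        using z(1) \<sigma>[of n] by (auto simp: inj_on_def X_def)
      show "poly (p n) (of_real (X n (z i))) = 0" if "i < d" for i
        using F[of n "z i"] z(2)[OF that] A[of n] by simp
    qed
  qed
  thus ?thesis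
    unfolding p_def cofinite_eq_sequentially[symmetric] eventually_cofinite .
qed

end
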